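(* Let $A$ be a bounded pseudo-BCK algebra and let $\mathcal W=\mathcal{SM}(A)$ be the set of state-morphisms on $A$, with the topology induced by the product topology of $[0,1]^A$. For $a\in A$ let $f_a:\mathcal W\to[0,1]$, $f_a(V)=V(a)$. Then for any Bosbach state $s$ on $A$ there is a Borel probability measure $\mu$ on the Borel $\sigma$-algebra $\mathcal B(\mathcal W)$ such that $$s(a)=\int_{\mathcal W} f_a(V)\,d\mu(V)\quad\text{for all } a\in A.$$
   Context: A pseudo-BCK algebra is a structure $(A,\le,\rightarrow,\rightsquigarrow,1)$ with $\le$ a binary relation, $\rightarrow,\rightsquigarrow$ binary operations and $1\in A$, such that for all $x,y,z\in A$: $x\rightarrow y\le (y\rightarrow z)\rightsquigarrow(x\rightarrow z)$ and $x\rightsquigarrow y\le (y\rightsquigarrow z)\rightarrow(x\rightsquigarrow z)$; $x\le (x\rightarrow y)\rightsquigarrow y$ and $x\le (x\rightsquigarrow y)\rightarrow y$; $x\le x$; $x\le 1$; antisymmetry of $\le$; $x\le y$ iff $x\rightarrow y=1$ iff $x\rightsquigarrow y=1$. It is bounded if it has a least element $0$. A Bosbach state is a map $s:A\to[0,1]$ with $s(x)+s(x\rightarrow y)=s(y)+s(y\rightarrow x)$, $s(x)+s(x\rightsquigarrow y)=s(y)+s(y\rightsquigarrow x)$, $s(0)=0$, $s(1)=1$. A state-morphism is a map $m:A\to[0,1]$ with $m(0)=0$ and $m(x\rightarrow y)=m(x\rightsquigarrow y)=\min\{1-m(x)+m(y),1\}$. The Borel $\sigma$-algebra of a topological space is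 generated by its open sets. *)

theory Defs
  imports "HOL-Probability.Probability"
begin

text \<open>The underlying set of the algebra is the whole type \<open>'a\<close>.\<close>

locale pseudo_BCK =
  fixes le :: "'a \<Rightarrow> 'a \<Rightarrow> bool" (infix "\<sqsubseteq>" 50)
    and imp :: "'a \<Rightarrow> 'a \<Rightarrow> 'a" (infixr "\<rightarrow>" 65)
    and imp' :: "'a \<Rightarrow> 'a \<Rightarrow> 'a" (infixr "\<leadsto>" 65)
    and one :: 'a ("\<one>")
  assumes imp_trans: "x \<rightarrow> y \<sqsubseteq> (y \<rightarrow> z) \<leadsto> (x \<rightarrow> z)"
    and imp'_trans: "x \<leadsto> y \<sqsubseteq> (y \<leadsto> z) \<rightarrow> (x \<leadsto> z)"
    and le_imp_imp': "x \<sqsubseteq> (x \<rightarrow> y) \<leadsto> y"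
    and le_imp'_imp: "x \<sqsubseteq> (x \<leadsto> y) \<rightarrow> y"
    and le_refl: "x \<sqsubseteq> x"
    and le_one: "x \<sqsubseteq> \<one>"
    and le_antisym: "x \<sqsubseteq> y \<Longrightarrow> y \<sqsubseteq> x \<Longrightarrow> x = y"
    and le_iff_imp: "x \<sqsubseteq> y \<longleftrightarrow> x \<rightarrow> y = \<one>"
    and le_iff_imp': "x \<sqsubseteq> y \<longleftrightarrow> x \<leadsto> y = \<one>"

locale bounded_pseudo_BCK = pseudo_BCK +
  fixes zero :: 'a ("\<zero>")
  assumes zero_le: "\<zero> \<sqsubseteq> x"

definition bosbach_state ::
  "('a \<Rightarrow> 'a \<Rightarrow> 'a) \<Rightarrow> ('a \<Rightarrow> 'a \<Rightarrow> 'a) \<Rightarrow> 'a \<Rightarrow> 'a \<Rightarrow> ('a \<Rightarrow> real) \<Rightarrow> bool" where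
  "bosbach_state imp imp' one zero s \<longleftrightarrow>
     (\<forall>x. s x \<in> {0..1}) \<and>
     (\<forall>x y. s x + s (imp x y) = s y + s (imp y x)) \<and>
     (\<forall>x y. s x + s (imp' x y) = s y + s (imp' y x)) \<and>
     s zero = 0 \<and> s one = 1"

definition state_morphisms ::
  "('a \<Rightarrow> 'a \<Rightarrow> 'a) \<Rightarrow> ('a \<Rightarrow> 'a \<Rightarrow> 'a) \<Rightarrow> 'a \<Rightarrow> ('a \<Rightarrow> real) set" where
  "state_morphisms imp imp' zero =
     {m. (\<forall>x. m x \<in> {0..1}) \<and> m zero = 0 \<and>
         (\<forall>x y. m (imp x y) = min (1 - m x + m y) 1) \<and>
         (\<forall>x y. m (imp' x y) = min (1 - m x + m y) 1)}"

definition state_morphism_topology ::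
  "('a \<Rightarrow> 'a \<Rightarrow> 'a) \<Rightarrow> ('a \<Rightarrow> 'a \<Rightarrow> 'a) \<Rightarrow> 'a \<Rightarrow> ('a \<Rightarrow> real) topology" where
  "state_morphism_topology imp imp' zero =
     subtopology (product_topology (\<lambda>_. top_of_set {0..1}) UNIV) (state_morphisms imp imp' zero)"

lemma topspace_state_morphism_topology:
  "topspace (state_morphism_topology imp imp' zero) = state_morphisms imp imp' zero"
  by (auto simp: state_morphism_topology_def state_morphisms_def PiE_UNIV_domain)

text \<open>The library constant \<^const>\<open>borel\<close> is tied to the topology of a type; this one takes
  the topology as an argument. Only the \<open>\<sigma>\<close>-algebra is relevant, the measure is zero.\<close>

definition borel_of :: "'b topology \<Rightarrow> 'b measure" where
  "borel_of X = sigma (topspace X) {U. openin X U}"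

end

(*
  The state s is extended from evaluation at s on the span of the coordinates to a positive linear
  functional I on all bounded functions, with positivity tested on the state-morphisms only. This
  is possible because an affine continuous function on the compact convex set of Bosbach states
  attains its minimum at an extreme point, and extreme Bosbach states are state-morphisms. The
  finitely additive charge A |-> I(1_A) then yields an outer regular Borel measure in the manner of
  the Riesz representation theorem; no countability of the algebra is available, so the product
  sigma-algebra would not suffice.

  That an extreme s is a state-morphism is seen as follows. For u in A let
  t(y) = lim s(u -> (u -> ... (u -> y))). Then t satisfies the Bosbach identities and s is a convex
  combination of 1 - (1 - t)/c and 1 - (t - s)/(1 - c), where c = 1 - t(0). If s is extreme, then
  either t(0) = 1 and t is constantly 1, or s = 1 - (1 - t)/c and s(u) = 1 because t(u) = 1. For
  u = x -> y and v = y -> x one has t(v) = s(v), so s(v) = 1 or s(u) = 1.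
*)
theory Submission
  imports Defs
begin

no_notation funcset (infixr "\<rightarrow>" 60)

subsection \<open>Pseudo-BCK algebras\<close>

text \<open>The axioms are symmetric in the two arrows, so every fact also holds with the arrows
  exchanged and is then cited with the prefix \<open>dual\<close>.\<close>

sublocale pseudo_BCK \<subseteq> dual: pseudo_BCK le imp' imp one
  by unfold_locales
    (rule imp'_trans imp_trans le_imp'_imp le_imp_imp' le_refl le_one le_iff_imp le_iff_imp'
      | (erule (1) le_antisym))+

sublocale bounded_pseudo_BCK \<subseteq> dual: bounded_pseudo_BCK le imp' imp one zero
  by unfold_locales (rule zero_le)

lemma (in pseudo_BCK) one_le_iff: "\<one> \<sqsubseteq> x \<longleftrightarrow> x = \<one>"
  using le_one le_refl le_antisym by metis

lemma (in pseudo_BCK) imp_antimono: "x \<sqsubseteq> y \<Longrightarrow> y \<rightarrow> z \<sqsubseteq> x \<rightarrow> z"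
  using imp_trans[of x y z] one_le_iff le_iff_imp le_iff_imp' by metis

lemma (in pseudo_BCK) le_trans: "x \<sqsubseteq> y \<Longrightarrow> y \<sqsubseteq> z \<Longrightarrow> x \<sqsubseteq> z"
  using imp_antimono one_le_iff le_iff_imp by metis

lemma (in pseudo_BCK) le_imp'_if_le_imp: "y \<sqsubseteq> x \<rightarrow> z \<Longrightarrow> x \<sqsubseteq> y \<leadsto> z"
  using le_trans[OF le_imp_imp' dual.imp_antimono] .

lemma (in pseudo_BCK) galois: "x \<sqsubseteq> y \<leadsto> z \<longleftrightarrow> y \<sqsubseteq> x \<rightarrow> z"
  using le_imp'_if_le_imp dual.le_imp'_if_le_imp by blast

lemma (in pseudo_BCK) imp_compose: "y \<rightarrow> z \<sqsubseteq> (x \<rightarrow> y) \<rightarrow> (x \<rightarrow> z)"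
  using imp_trans galois by blast

lemma (in pseudo_BCK) imp_mono: "y \<sqsubseteq> z \<Longrightarrow> x \<rightarrow> y \<sqsubseteq> x \<rightarrow> z"
  by (metis imp_compose le_iff_imp one_le_iff)

lemma (in pseudo_BCK) exchange_le: "x \<rightarrow> (y \<leadsto> z) \<sqsubseteq> y \<leadsto> (x \<rightarrow> z)"
  unfolding galois by (rule le_trans[OF le_imp'_imp imp_compose])

lemma (in pseudo_BCK) exchange: "x \<rightarrow> (y \<leadsto> z) = y \<leadsto> (x \<rightarrow> z)"
  using exchange_le dual.exchange_le le_antisym by blast

lemma (in pseudo_BCK) le_imp: "y \<sqsubseteq> x \<rightarrow> y"
  using galois le_one le_iff_imp' le_refl by metis

text \<open>The triple law of the Galois connection \<open>galois\<close>: one inequality is the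
  unit \<open>x \<sqsubseteq> (x \<rightarrow> y) \<leadsto> y\<close> under an antitone map, the
  other is the unit at \<open>x \<rightarrow> y\<close>.\<close>

lemma (in pseudo_BCK) imp_imp'_imp: "((x \<rightarrow> y) \<leadsto> y) \<rightarrow> y = x \<rightarrow> y"
  by (rule le_antisym[OF imp_antimono[OF le_imp_imp'] le_imp'_imp])

lemma (in bounded_pseudo_BCK) zero_imp: "\<zero> \<rightarrow> x = \<one>"
  using zero_le le_iff_imp by blast

subsection \<open>Bosbach states\<close>

locale bosbach = bounded_pseudo_BCK +
  fixes s :: "'a \<Rightarrow> real"
  assumes bosbach_state: "bosbach_state imp imp' one zero s"
begin

lemma state_bounds: "0 \<le> s x" "s x \<le> 1"
  and state_imp: "s x + s (x \<rightarrow> y) = s y + s (y \<rightarrow> x)"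
  and state_imp': "s x + s (x \<leadsto> y) = s y + s (y \<leadsto> x)"
  and state_zero: "s \<zero> = 0"
  and state_one: "s \<one> = 1"
  using bosbach_state unfolding bosbach_state_def by auto

end

lemma bosbach_state_dual:
  "bosbach_state imp imp' one zero s \<Longrightarrow> bosbach_state imp' imp one zero s"
  unfolding bosbach_state_def by blast

sublocale bosbach \<subseteq> dual: bosbach le imp' imp one zero s
  by unfold_locales (rule bosbach_state_dual[OF bosbach_state])

lemma (in bosbach) state_imp_of_le: "x \<sqsubseteq> y \<Longrightarrow> s (y \<rightarrow> x) = 1 - s y + s x"
  using state_imp[of x y] le_iff_imp[of x y] state_one by simp

lemma (in bosbach) state_mono: "x \<sqsubseteq> y \<Longrightarrow> s x \<le> s y"
  using state_imp_of_le[of x y] state_bounds(2)[of "y \<rightarrow> x"] by linarith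

text \<open>For a target below the source both arrows have the value given by
  \<open>state_imp_of_le\<close>. The triple law reduces to this case: \<open>x \<leadsto> y\<close>
  equals \<open>j \<leadsto> y\<close> with \<open>y \<sqsubseteq> j\<close>, and
  \<open>x \<sqsubseteq> j\<close> allows the return from \<open>j\<close> to
  \<open>x\<close>.\<close>

lemma (in bosbach) state_imp'_le_state_imp: "s (x \<leadsto> y) \<le> s (x \<rightarrow> y)"
proof -
  define j where "j = (x \<leadsto> y) \<rightarrow> y"
  have "s (x \<leadsto> y) = s (j \<leadsto> y)"
    unfolding j_def by (simp only: dual.imp_imp'_imp)
  also have "\<dots> = s (j \<rightarrow> y)"
    using state_imp_of_le dual.state_imp_of_le le_imp unfolding j_def by metis
  also have "\<dots> \<le> s (x \<rightarrow> y)"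
    unfolding j_def by (intro state_mono imp_antimono le_imp'_imp)
  finally show ?thesis .
qed

lemma (in bosbach) state_imp'_eq: "s (x \<leadsto> y) = s (x \<rightarrow> y)"
  using state_imp'_le_state_imp dual.state_imp'_le_state_imp order.antisym by blast

text \<open>The order of the quotient by the deductive system of all elements of value 1.\<close>

definition (in bosbach) qle :: "'a \<Rightarrow> 'a \<Rightarrow> bool" (infix "\<preceq>" 50)
  where "x \<preceq> y \<longleftrightarrow> s (x \<rightarrow> y) = 1"

lemma (in bosbach) qle_iff_imp': "x \<preceq> y \<longleftrightarrow> s (x \<leadsto> y) = 1"
  by (simp add: qle_def state_imp'_eq)

lemma (in bosbach) qle_state_mono: "x \<preceq> y \<Longrightarrow> s x \<le> s y"
  using state_imp[of x y] state_bounds(2)[of "y \<rightarrow> x"] unfolding qle_def by linarith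

lemma (in bosbach) qle_of_le: "x \<sqsubseteq> y \<Longrightarrow> x \<preceq> y"
  unfolding qle_def using le_iff_imp state_one by metis

text \<open>Comparable elements of equal value are identified in the quotient; later collapses are
  proved by comparing values.\<close>

lemma (in bosbach) qle_of_state_le: "x \<sqsubseteq> y \<Longrightarrow> s y \<le> s x \<Longrightarrow> y \<preceq> x"
  unfolding qle_def using state_imp_of_le[of x y] state_mono[of x y] by linarith

lemma (in bosbach) qle_imp_antimono: "x \<preceq> y \<Longrightarrow> y \<rightarrow> z \<preceq> x \<rightarrow> z"
  using state_mono[OF imp_trans[of x y z]] state_bounds(2)[of "(y \<rightarrow> z) \<leadsto> (x \<rightarrow> z)"]
  unfolding qle_iff_imp'[of "y \<rightarrow> z"] unfolding qle_def by linarith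

lemma (in bosbach) qle_trans: "x \<preceq> y \<Longrightarrow> y \<preceq> z \<Longrightarrow> x \<preceq> z"
  using qle_state_mono[OF qle_imp_antimono, of x y z] state_bounds(2)[of "x \<rightarrow> z"]
  unfolding qle_def by linarith

lemma (in bosbach) qle_imp_mono: "x \<preceq> y \<Longrightarrow> z \<rightarrow> x \<preceq> z \<rightarrow> y"
  using state_mono[OF imp_compose[of x y z]] state_bounds(2)[of "(z \<rightarrow> x) \<rightarrow> (z \<rightarrow> y)"]
  unfolding qle_def by linarith

lemma (in bosbach) dual_qle: "dual.qle = qle"
  by (intro ext) (simp add: qle_iff_imp' dual.qle_def)

lemma (in bosbach) qle_imp'_antimono: "x \<preceq> y \<Longrightarrow> y \<leadsto> z \<preceq> x \<leadsto> z"
  using dual.qle_imp_antimono by (simp only: dual_qle)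

text \<open>Modulo \<open>\<preceq>\<close>, the element \<open>(x \<rightarrow> y) \<leadsto> y\<close> is the join of \<open>x\<close> and \<open>y\<close>.\<close>

lemma (in bosbach) join_least:
  assumes "x \<preceq> z" "y \<preceq> z"
  shows "(x \<rightarrow> y) \<leadsto> y \<preceq> z"
proof -
  \<comment> \<open>The join of \<open>z\<close> with the smaller element \<open>y\<close> collapses
    to \<open>z\<close>, as both have the same value. Antitonicity applied twice then compares it
    with the join of \<open>x\<close> and \<open>y\<close>.\<close>
  have "(z \<rightarrow> y) \<leadsto> y \<preceq> z"
  proof (rule qle_of_state_le[OF _])
    show "z \<sqsubseteq> (z \<rightarrow> y) \<leadsto> y" by (rule le_imp_imp')
    have "s z + s (z \<rightarrow> y) = s y + 1"
      using state_imp[of z y] assms(2) unfolding qle_def by linarith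
    then show "s ((z \<rightarrow> y) \<leadsto> y) \<le> s z"
      using dual.state_imp_of_le[OF le_imp[of y z]] by linarith
  qed
  with qle_imp'_antimono[OF qle_imp_antimono[OF assms(1)]] show ?thesis
    by (rule qle_trans)
qed

text \<open>In the quotient by \<open>\<preceq>\<close>, prelinearity says that \<open>x \<rightarrow> y\<close> and \<open>y \<rightarrow> x\<close> have join \<open>1\<close>.
  Given \<open>w\<close> above both and \<open>c = x \<squnion> y\<close>, the negation of \<open>q = w \<rightarrow> \<not> c\<close> dominates
  \<open>x\<close> and \<open>y\<close>, hence \<open>c\<close>; comparing the values of the state forces \<open>s w = 1\<close>.\<close>

lemma (in bosbach) prelinearity:
  assumes "x \<rightarrow> y \<sqsubseteq> w" "y \<rightarrow> x \<sqsubseteq> w"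
  shows "s w = 1"
proof -
  define c where "c = (x \<rightarrow> y) \<leadsto> y"
  define q where "q = w \<rightarrow> (c \<rightarrow> \<zero>)"
  \<comment> \<open>Contraposition \<open>z \<rightarrow> \<zero> \<sqsubseteq> (c \<rightarrow> z)
    \<rightarrow> (c \<rightarrow> \<zero>)\<close> becomes an equivalence in the quotient, since
    both sides have value \<open>1 - s z\<close>. Replacing \<open>c \<rightarrow> z\<close> by the
    larger \<open>w\<close> puts \<open>q\<close> below
    \<open>z \<rightarrow> \<zero>\<close>.\<close>
  have below: "z \<preceq> q \<leadsto> \<zero>" if "z \<sqsubseteq> c" "c \<rightarrow> z \<sqsubseteq> w" for z
  proof -
    have "z \<rightarrow> \<zero> \<sqsubseteq> (c \<rightarrow> z) \<rightarrow> (c \<rightarrow> \<zero>)" by (rule imp_compose)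
    moreover have "s ((c \<rightarrow> z) \<rightarrow> (c \<rightarrow> \<zero>)) = s (z \<rightarrow> \<zero>)"
      using state_imp_of_le[OF imp_mono[OF zero_le, of c z]] state_imp_of_le[OF that(1)]
        state_imp_of_le[OF zero_le] by simp
    ultimately have "(c \<rightarrow> z) \<rightarrow> (c \<rightarrow> \<zero>) \<preceq> z \<rightarrow> \<zero>"
      using qle_of_state_le by simp
    with qle_of_le[OF imp_antimono[OF that(2)]] have "q \<preceq> z \<rightarrow> \<zero>"
      unfolding q_def by (rule qle_trans)
    then show ?thesis
      using qle_trans[OF qle_of_le[OF le_imp_imp'] qle_imp'_antimono] by blast
  qed
  have le_c: "x \<sqsubseteq> c" "y \<sqsubseteq> c"
    unfolding c_def by (rule le_imp_imp' dual.le_imp)+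
  have "c \<preceq> q \<leadsto> \<zero>"
    unfolding c_def
    by (rule join_least[OF below[OF le_c(1)] below[OF le_c(2)]])
      \<comment> \<open>As \<open>c\<close> dominates \<open>x\<close> and \<open>y\<close>, both
        \<open>c \<rightarrow> x \<sqsubseteq> y \<rightarrow> x\<close> and
        \<open>c \<rightarrow> y \<sqsubseteq> x \<rightarrow> y\<close> lie below
        \<open>w\<close>.\<close>
      (rule le_trans[OF imp_antimono[OF le_c(2)] assms(2)]
        le_trans[OF imp_antimono[OF le_c(1)] assms(1)])+
  then have "s c \<le> s (q \<leadsto> \<zero>)" by (rule qle_state_mono)
  also have "\<dots> = 1 - s q"
    using dual.state_imp_of_le[OF zero_le] state_zero by simp
  also have "s q = 1 - s w + (1 - s c)"
  proof -
    have "c \<rightarrow> \<zero> \<sqsubseteq> w"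
      using le_trans[OF imp_mono[OF zero_le] le_trans[OF imp_antimono[OF le_c(1)] assms(1)]] .
    then show ?thesis
      unfolding q_def using state_imp_of_le zero_le state_zero by simp
  qed
  finally show ?thesis
    using state_bounds(2)[of w] by linarith
qed

subsection \<open>Extreme Bosbach states are state-morphisms\<close>

text \<open>The algebra has no product, so the iterate of \<open>(\<rightarrow>) u\<close> stands in
  for the arrow from the \<open>n\<close>-th power of \<open>u\<close>.\<close>

lemma (in pseudo_BCK) le_iterate: "y \<sqsubseteq> ((\<rightarrow>) u ^^ n) y"
  by (induction n) (auto intro: le_refl le_trans[OF _ le_imp])

lemma (in pseudo_BCK) iterate_mono: "x \<sqsubseteq> y \<Longrightarrow> ((\<rightarrow>) u ^^ n) x \<sqsubseteq> ((\<rightarrow>) u ^^ n) y"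
  by (induction n) (auto intro: imp_mono)

lemma (in pseudo_BCK) iterate_imp': "((\<rightarrow>) u ^^ n) (x \<leadsto> y) = x \<leadsto> ((\<rightarrow>) u ^^ n) y"
  by (induction n) (auto simp: exchange)

lemma (in pseudo_BCK) imp_le_iterate: "x \<rightarrow> y \<sqsubseteq> ((\<rightarrow>) u ^^ n) x \<rightarrow> ((\<rightarrow>) u ^^ n) y"
  by (induction n) (auto intro: le_refl le_trans[OF _ imp_compose])

text \<open>Exchange moves one dual arrow to the outermost position, where the state no longer
  distinguishes it from the other arrow.\<close>

lemma (in bosbach) state_iterate_iterate':
  "s (((\<rightarrow>) u ^^ n) (((\<leadsto>) u ^^ m) y)) = s (((\<rightarrow>) u ^^ (n + m)) y)"
proof (induction m arbitrary: n)
  case (Suc m)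
  have "s (((\<rightarrow>) u ^^ n) (((\<leadsto>) u ^^ Suc m) y)) = s (u \<leadsto> ((\<rightarrow>) u ^^ n) (((\<leadsto>) u ^^ m) y))"
    by (simp add: iterate_imp')
  also have "\<dots> = s (((\<rightarrow>) u ^^ Suc n) (((\<leadsto>) u ^^ m) y))"
    by (simp add: state_imp'_eq)
  also have "\<dots> = s (((\<rightarrow>) u ^^ (n + Suc m)) y)"
    using Suc.IH[of "Suc n"] by simp
  finally show ?case .
qed simp

lemma (in bosbach) state_iterate': "s (((\<leadsto>) u ^^ n) y) = s (((\<rightarrow>) u ^^ n) y)"
  using state_iterate_iterate'[of 0 u n y] by simp

lemma (in bosbach) state_iterate'_iterate:
  "s (((\<leadsto>) u ^^ n) (((\<rightarrow>) u ^^ m) y)) = s (((\<rightarrow>) u ^^ (n + m)) y)"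
  using dual.state_iterate_iterate'[of n u m y] by (simp add: state_iterate')

text \<open>This is the Bosbach identity for \<open>?x\<close> and \<open>?y\<close>. Exchange pulls
  iterates only through the opposite arrow, hence the mixed iterates in \<open>?y\<close>, the
  doubled exponent and the opposite arrow on the right.\<close>

lemma (in bosbach) state_iterate_imp_le:
  "s (((\<rightarrow>) u ^^ n) x) + s (((\<rightarrow>) u ^^ n) (x \<rightarrow> y))
    \<le> s (((\<rightarrow>) u ^^ (n + n)) y) + s (((\<rightarrow>) u ^^ n) (y \<leadsto> x))"
proof -
  let ?x = "((\<rightarrow>) u ^^ n) x" and ?y = "((\<leadsto>) u ^^ n) (((\<rightarrow>) u ^^ n) y)"
  have "s (((\<rightarrow>) u ^^ n) (x \<rightarrow> y)) = s (((\<leadsto>) u ^^ n) (x \<rightarrow> y))"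
    by (rule state_iterate'[symmetric])
  also have "\<dots> \<le> s (((\<leadsto>) u ^^ n) (((\<rightarrow>) u ^^ n) x \<rightarrow> ((\<rightarrow>) u ^^ n) y))"
    by (intro state_mono dual.iterate_mono imp_le_iterate)
  also have "\<dots> = s (?x \<rightarrow> ?y)"
    by (simp only: dual.iterate_imp')
  finally have "s (((\<rightarrow>) u ^^ n) (x \<rightarrow> y)) \<le> s (?x \<rightarrow> ?y)" .
  moreover have "s (?y \<rightarrow> ?x) \<le> s (((\<rightarrow>) u ^^ n) (y \<leadsto> x))"
  proof -
    have "s (?y \<rightarrow> ?x) \<le> s (y \<rightarrow> ?x)"
      by (intro state_mono imp_antimono le_trans[OF le_iterate dual.le_iterate])
    then show ?thesis by (simp only: iterate_imp' state_imp'_eq)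
  qed
  ultimately show ?thesis
    using state_imp[of ?x ?y] state_iterate'_iterate[of n u n y] by linarith
qed

text \<open>If the powers of \<open>u\<close> converged to an idempotent \<open>e\<close>, this would be \<open>s (e \<rightarrow> y)\<close>.\<close>

definition (in bosbach) sat :: "'a \<Rightarrow> 'a \<Rightarrow> real"
  where "sat u y = lim (\<lambda>n. s (((\<rightarrow>) u ^^ n) y))"

lemma (in bosbach) incseq_iterate: "incseq (\<lambda>n. s (((\<rightarrow>) u ^^ n) y))"
  by (intro incseq_SucI) (simp add: state_mono le_imp)

lemma (in bosbach) tendsto_sat: "(\<lambda>n. s (((\<rightarrow>) u ^^ n) y)) \<longlonglongrightarrow> sat u y"
  unfolding sat_def convergent_LIMSEQ_iff[symmetric]
  by (rule Bseq_mono_convergent)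
    (auto intro!: BseqI'[of _ 1] incseqD[OF incseq_iterate] simp: state_bounds abs_le_iff
      intro: order.trans[OF _ state_bounds(1)])

lemma (in bosbach) state_le_sat: "s (((\<rightarrow>) u ^^ n) y) \<le> sat u y"
  by (rule incseq_le[OF incseq_iterate tendsto_sat])

lemma (in bosbach) sat_le_1: "sat u y \<le> 1"
  by (rule LIMSEQ_le_const2[OF tendsto_sat]) (simp add: state_bounds)

lemma (in bosbach) sat_mono: "x \<sqsubseteq> y \<Longrightarrow> sat u x \<le> sat u y"
  by (rule LIMSEQ_le[OF tendsto_sat tendsto_sat]) (auto intro: state_mono iterate_mono)

lemma (in bosbach) sat_one: "sat u \<one> = 1"
  using state_le_sat[of 0 u \<one>] sat_le_1[of u \<one>] state_one by simp

lemma (in bosbach) sat_self: "sat u u = 1"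
  using state_le_sat[of 1 u u] sat_le_1[of u u] le_refl[of u] state_one le_iff_imp[of u u] by simp

lemma (in bosbach) sat_fixed:
  assumes "u \<rightarrow> y \<preceq> y"
  shows "sat u y = s y"
proof -
  have "((\<rightarrow>) u ^^ n) y \<preceq> y" for n
    by (induction n) (auto intro: qle_of_le le_refl qle_trans[OF qle_imp_mono assms])
  then have "s (((\<rightarrow>) u ^^ n) y) = s y" for n
    using qle_state_mono state_mono[OF le_iterate] by (metis order.antisym)
  then show ?thesis
    using LIMSEQ_unique[OF tendsto_sat] by simp
qed

text \<open>In the limit the doubled exponent disappears, because \<open>n + n\<close> runs through
  a subsequence.\<close>

lemma (in bosbach) sat_imp_le: "sat u x + sat u (x \<rightarrow> y) \<le> sat u y + sat u (y \<leadsto> x)"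
proof (rule LIMSEQ_le)
  show "(\<lambda>n. s (((\<rightarrow>) u ^^ n) x) + s (((\<rightarrow>) u ^^ n) (x \<rightarrow> y))) \<longlonglongrightarrow> sat u x + sat u (x \<rightarrow> y)"
    by (intro tendsto_intros tendsto_sat)
  have "strict_mono (\<lambda>n::nat. n + n)" by (auto simp: strict_mono_def)
  from LIMSEQ_subseq_LIMSEQ[OF tendsto_sat this]
  show "(\<lambda>n. s (((\<rightarrow>) u ^^ (n + n)) y) + s (((\<rightarrow>) u ^^ n) (y \<leadsto> x))) \<longlonglongrightarrow> sat u y + sat u (y \<leadsto> x)"
    by (intro tendsto_intros tendsto_sat) (simp add: o_def)
qed (use state_iterate_imp_le in blast)

lemma (in bosbach) dual_sat: "dual.sat = sat"
  by (intro ext) (simp add: dual.sat_def sat_def state_iterate')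

lemma (in bosbach) sat_imp_cross: "sat u x + sat u (x \<rightarrow> y) = sat u y + sat u (y \<leadsto> x)"
  using sat_imp_le dual.sat_imp_le by (simp add: dual_sat order.antisym)

lemma (in bosbach) sat_imp_of_le:
  assumes "x \<sqsubseteq> y"
  shows "sat u (y \<rightarrow> x) = 1 - sat u y + sat u x" "sat u (y \<leadsto> x) = 1 - sat u y + sat u x"
  using sat_imp_cross[of u x y] sat_imp_cross[of u y x] sat_one[of u] assms
    le_iff_imp[of x y] le_iff_imp'[of x y] by simp_all

text \<open>The argument of \<open>state_imp'_le_state_imp\<close> carries over, with
  \<open>sat_imp_of_le\<close> for comparable elements.\<close>

lemma (in bosbach) sat_imp'_le_sat_imp: "sat u (x \<leadsto> y) \<le> sat u (x \<rightarrow> y)"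
proof -
  define j where "j = (x \<leadsto> y) \<rightarrow> y"
  have "sat u (x \<leadsto> y) = sat u (j \<leadsto> y)"
    unfolding j_def by (simp only: dual.imp_imp'_imp)
  also have "\<dots> = sat u (j \<rightarrow> y)"
    unfolding j_def by (simp only: sat_imp_of_le[OF le_imp])
  also have "\<dots> \<le> sat u (x \<rightarrow> y)"
    unfolding j_def by (intro sat_mono imp_antimono le_imp'_imp)
  finally show ?thesis .
qed

lemma (in bosbach) sat_imp'_eq: "sat u (x \<leadsto> y) = sat u (x \<rightarrow> y)"
  using sat_imp'_le_sat_imp dual.sat_imp'_le_sat_imp by (simp add: dual_sat order.antisym)

lemma (in bosbach) sat_imp: "sat u x + sat u (x \<rightarrow> y) = sat u y + sat u (y \<rightarrow> x)"
  using sat_imp_cross[of u x y] by (simp add: sat_imp'_eq)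

text \<open>Prelinearity applies to \<open>(?u \<rightarrow> ?v) \<leadsto> ?v\<close>, which lies
  above \<open>?u\<close> and \<open>?v\<close>; hence arrows from \<open>?u\<close> leave the value
  at \<open>?v\<close> unchanged.\<close>

lemma (in bosbach) sat_imp_converse:
  "sat (x \<rightarrow> y) (y \<rightarrow> x) = s (y \<rightarrow> x)"
proof (rule sat_fixed)
  let ?u = "x \<rightarrow> y" and ?v = "y \<rightarrow> x"
  have "s ((?u \<rightarrow> ?v) \<leadsto> ?v) = 1"
    by (rule prelinearity[OF le_imp_imp' dual.le_imp])
  then show "?u \<rightarrow> ?v \<preceq> ?v" by (simp add: qle_iff_imp')
qed

text \<open>The lower bound \<open>0 \<le> t x\<close> is automatic, as \<open>t x = 1 - t (x \<rightarrow> 0)\<close>.\<close>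

lemma (in bounded_pseudo_BCK) bosbach_stateI:
  assumes "\<And>x. t x \<le> 1" "t \<zero> = 0" "t \<one> = 1"
    and imp: "\<And>x y. t x + t (x \<rightarrow> y) = t y + t (y \<rightarrow> x)"
    and imp': "\<And>x y. t x + t (x \<leadsto> y) = t y + t (y \<leadsto> x)"
  shows "bosbach_state imp imp' one zero t"
proof -
  have "0 \<le> t x" for x
    using imp[of x \<zero>] assms(1)[of "x \<rightarrow> \<zero>"] assms(2,3) zero_imp[of x] by simp
  then show ?thesis
    using assms unfolding bosbach_state_def by auto
qed

lemma (in bosbach) extreme_cases:
  assumes extreme: "\<And>t t' r. \<lbrakk>bosbach_state imp imp' one zero t; bosbach_state imp imp' one zero t';
      0 < r; r < 1; s = (\<lambda>x. r * t x + (1 - r) * t' x)\<rbrakk> \<Longrightarrow> t = s"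
  shows "sat u \<zero> = 1 \<or> s u = 1"
proof -
  define c where "c = 1 - sat u \<zero>"
  have le_sat: "s x \<le> sat u x" for x
    using state_le_sat[of 0 u x] by simp
  have c: "0 \<le> c" "c \<le> 1"
    unfolding c_def using sat_le_1[of u \<zero>] le_sat[of \<zero>] state_zero by auto
  consider "c = 0" | "c = 1" | "0 < c" "c < 1" using c by fastforce
  then show ?thesis
  proof cases
    case 2
    \<comment> \<open>Here \<open>sat u \<zero> = 0\<close>, so the values at \<open>x\<close> and
      \<open>x \<rightarrow> \<zero>\<close> add up to 1 for \<open>sat u\<close> as well as for
      \<open>s\<close>. Since \<open>s\<close> lies below \<open>sat u\<close>, both terms
      agree.\<close>
    have "sat u x = s x" for x
    proof -
      have "sat u x + sat u (x \<rightarrow> \<zero>) = s x + s (x \<rightarrow> \<zero>)"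
        using sat_imp[of u x \<zero>] state_imp[of x \<zero>] 2 unfolding c_def
        by (simp add: zero_imp sat_one state_one state_zero)
      then show ?thesis using le_sat[of x] le_sat[of "x \<rightarrow> \<zero>"] by linarith
    qed
    then show ?thesis using sat_self[of u] by simp
  next
    case 3
    \<comment> \<open>Both functions are normalised to be 0 at \<open>\<zero>\<close> and 1 at
      \<open>\<one>\<close>. The upper bound for \<open>t\<close> is \<open>sat_le_1\<close>, that
      for \<open>t'\<close> is \<open>le_sat\<close>.\<close>
    define t where "t x = 1 - (1 - sat u x) / c" for x
    define t' where "t' x = 1 - (sat u x - s x) / (1 - c)" for x
    have "bosbach_state imp imp' one zero t"
    proof (rule bosbach_stateI)
      show "t x + t (x \<rightarrow> y) = t y + t (y \<rightarrow> x)" "t x + t (x \<leadsto> y) = t y + t (y \<leadsto> x)" for x y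
        using sat_imp[of u x y] 3 unfolding t_def sat_imp'_eq
        by (simp_all add: field_simps flip: add_divide_distrib)
    qed (use 3 sat_le_1 in \<open>auto simp: t_def c_def sat_one\<close>)
    moreover have "bosbach_state imp imp' one zero t'"
    proof (rule bosbach_stateI)
      show "t' x + t' (x \<rightarrow> y) = t' y + t' (y \<rightarrow> x)" "t' x + t' (x \<leadsto> y) = t' y + t' (y \<leadsto> x)" for x y
        using sat_imp[of u x y] state_imp[of x y] 3 unfolding t'_def sat_imp'_eq state_imp'_eq
        by (simp_all add: field_simps flip: add_divide_distrib)
    qed (use 3 le_sat in \<open>auto simp: t'_def c_def sat_one state_one state_zero\<close>)
    moreover have "s = (\<lambda>x. c * t x + (1 - c) * t' x)"
    proof
      fix x
      have "c * t x = c - (1 - sat u x)" "(1 - c) * t' x = (1 - c) - (sat u x - s x)"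
        using 3 unfolding t_def t'_def right_diff_distrib by simp_all
      then show "s x = c * t x + (1 - c) * t' x" by linarith
    qed
    ultimately have "t = s" using extreme 3 by blast
    then have "s u = t u" by simp
    then show ?thesis by (simp add: t_def sat_self)
  qed (simp add: c_def)
qed

lemma (in bosbach) extreme_state_morphism:
  assumes extreme: "\<And>t t' r. \<lbrakk>bosbach_state imp imp' one zero t; bosbach_state imp imp' one zero t';
      0 < r; r < 1; s = (\<lambda>x. r * t x + (1 - r) * t' x)\<rbrakk> \<Longrightarrow> t = s"
  shows "s \<in> state_morphisms imp imp' zero"
proof -
  have "s (x \<rightarrow> y) = min (1 - s x + s y) 1" for x y
  proof -
    \<comment> \<open>If the saturation at \<open>x \<rightarrow> y\<close> is 1 at
      \<open>\<zero>\<close>, it is 1 at \<open>y \<rightarrow> x\<close>, where it agrees with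
      \<open>s\<close>. Once one of the two arrows has value 1, the Bosbach identity yields the
      truncated formula.\<close>
    have "s (x \<rightarrow> y) = 1 \<or> s (y \<rightarrow> x) = 1"
    proof (rule disjE[OF extreme_cases[OF extreme, where u = "x \<rightarrow> y"]])
      assume "sat (x \<rightarrow> y) \<zero> = 1"
      then have "s (y \<rightarrow> x) = 1"
        using sat_mono[OF zero_le, of "x \<rightarrow> y" "y \<rightarrow> x"] sat_le_1 sat_imp_converse[of x y]
        by (metis order.antisym)
      then show ?thesis ..
    qed auto
    then show ?thesis
      using state_imp[of x y] state_bounds(2)[of "x \<rightarrow> y"] state_bounds(2)[of "y \<rightarrow> x"] by linarith
  qed
  then show ?thesis
    by (simp add: state_morphisms_def state_imp'_eq state_bounds state_zero)
qed

text \<open>The type class \<open>t2_space\<close> is not available for functions from an uncountable type,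
  so separation is expressed by \<open>Hausdorff_space\<close>.\<close>

lemma Hausdorff_space_fun: "Hausdorff_space (euclidean :: ('a \<Rightarrow> real) topology)"
  using Hausdorff_space_product_topology[of "\<lambda>_. euclidean :: real topology" "UNIV :: 'a set"]
  by (simp add: euclidean_product_topology)

lemma compact_imp_closed_Hausdorff:
  "Hausdorff_space (euclidean :: 'b::topological_space topology) \<Longrightarrow> compact (K :: 'b set) \<Longrightarrow> closed K"
  using compactin_imp_closedin[of euclidean K] by simp

subsection \<open>A maximum principle of Bauer type\<close>

text \<open>The closed extremal sets of the Krein-Milman argument, with convex combinations written
  pointwise.\<close>

definition face :: "('a \<Rightarrow> real) set \<Rightarrow> ('a \<Rightarrow> real) set \<Rightarrow> bool" where
  "face K F \<longleftrightarrow> F \<subseteq> K \<and> F \<noteq> {} \<and> closed F \<and>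
    (\<forall>t\<in>K. \<forall>t'\<in>K. \<forall>r. 0 < r \<longrightarrow> r < 1 \<longrightarrow> (\<lambda>x. r * t x + (1 - r) * t' x) \<in> F \<longrightarrow> t \<in> F \<and> t' \<in> F)"

definition affine_fun_on :: "('a \<Rightarrow> real) set \<Rightarrow> (('a \<Rightarrow> real) \<Rightarrow> real) \<Rightarrow> bool" where
  "affine_fun_on K g \<longleftrightarrow> (\<forall>t\<in>K. \<forall>t'\<in>K. \<forall>r. 0 < r \<longrightarrow> r < 1 \<longrightarrow> (\<lambda>x. r * t x + (1 - r) * t' x) \<in> K \<longrightarrow>
    g (\<lambda>x. r * t x + (1 - r) * t' x) = r * g t + (1 - r) * g t')"

lemma affine_fun_on_add:
  fixes K :: "('a \<Rightarrow> real) set"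
  assumes "affine_fun_on K f" "affine_fun_on K g"
  shows "affine_fun_on K (\<lambda>t. f t + g t)"
  unfolding affine_fun_on_def
proof (intro ballI allI impI)
  fix t t' :: "'a \<Rightarrow> real" and r :: real
  let ?c = "\<lambda>x. r * t x + (1 - r) * t' x"
  assume "t \<in> K" "t' \<in> K" "0 < r" "r < 1" "?c \<in> K"
  then have "f ?c = r * f t + (1 - r) * f t'" "g ?c = r * g t + (1 - r) * g t'"
    using assms unfolding affine_fun_on_def by simp_all
  then show "f ?c + g ?c = r * (f t + g t) + (1 - r) * (f t' + g t')"
    by (simp only: distrib_left add.assoc add.left_commute add.commute)
qed

lemma affine_fun_on_mult_left:
  fixes K :: "('a \<Rightarrow> real) set"
  assumes "affine_fun_on K f"
  shows "affine_fun_on K (\<lambda>t. a * f t)"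
  unfolding affine_fun_on_def
proof (intro ballI allI impI)
  fix t t' :: "'a \<Rightarrow> real" and r :: real
  let ?c = "\<lambda>x. r * t x + (1 - r) * t' x"
  assume "t \<in> K" "t' \<in> K" "0 < r" "r < 1" "?c \<in> K"
  then have "f ?c = r * f t + (1 - r) * f t'"
    using assms unfolding affine_fun_on_def by simp
  then show "a * f ?c = r * (a * f t) + (1 - r) * (a * f t')"
    by (simp only: distrib_left mult.left_commute)
qed

lemma face_Int_nonempty: "face K F \<Longrightarrow> K \<inter> F \<noteq> {}"
  unfolding face_def by (simp add: Int_absorb1)

text \<open>If a maximiser is a proper convex combination of two points of \<open>K\<close>, both
  lie in \<open>F\<close>. By affinity their gaps to the maximum have weighted sum 0, so both gaps
  vanish.\<close>

lemma face_argmax: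
  assumes K: "compact K" and F: "face K F" and cont: "continuous_on K g" and aff: "affine_fun_on K g"
  shows "face K {t \<in> F. \<forall>t'\<in>F. g t' \<le> g t}"
proof -
  have FK: "F \<subseteq> K" "F \<noteq> {}" "closed F" using F by (auto simp: face_def)
  have "compact F" using compact_Int_closed[OF K FK(3)] FK(1) by (simp add: Int_absorb1)
  then obtain m where m: "m \<in> F" "\<And>t. t \<in> F \<Longrightarrow> g t \<le> g m"
    using continuous_attains_sup[OF _ FK(2) continuous_on_subset[OF cont FK(1)]] by blast
  have eq: "{t \<in> F. \<forall>t'\<in>F. g t' \<le> g t} = {t \<in> F. g t = g m}"
    using m by (auto intro: order.antisym)
  show ?thesis
    unfolding eq face_def
  proof (intro conjI ballI allI impI)
    show "closed {t \<in> F. g t = g m}"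
      by (rule continuous_closed_preimage_constant[OF continuous_on_subset[OF cont FK(1)] FK(3)])
    fix t t' r
    assume *: "t \<in> K" "t' \<in> K" "0 < r" "r < (1::real)"
      and in_max: "(\<lambda>x. r * t x + (1 - r) * t' x) \<in> {t \<in> F. g t = g m}"
    have tF: "t \<in> F" "t' \<in> F"
      using F * in_max unfolding face_def by blast+
    have "r * g t + (1 - r) * g t' = g m"
      using aff * in_max FK(1) unfolding affine_fun_on_def by fastforce
    then have "r * (g m - g t) + (1 - r) * (g m - g t') = 0"
      by (simp add: algebra_simps)
    moreover have "0 \<le> r * (g m - g t)" "0 \<le> (1 - r) * (g m - g t')"
      using * m(2)[OF tF(1)] m(2)[OF tF(2)] by simp_all
    ultimately have "r * (g m - g t) = 0" "(1 - r) * (g m - g t') = 0" by linarith+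
    then show "t \<in> {t \<in> F. g t = g m}" "t' \<in> {t \<in> F. g t = g m}"
      using * tF by auto
  qed (use FK m(1) in auto)
qed

text \<open>Zorn's lemma for reverse inclusion. A finite nonempty subchain contains its own
  intersection, so compactness makes the intersection of any chain nonempty.\<close>

lemma face_contains_minimal:
  assumes K: "compact K" and F: "face K F"
  obtains M where "face K M" "M \<subseteq> F" "\<And>G. face K G \<Longrightarrow> G \<subseteq> M \<Longrightarrow> G = M"
proof -
  define A where "A = {G. face K G \<and> G \<subseteq> F}"
  have "\<exists>M\<in>A. \<forall>G\<in>A. M \<supseteq> G \<longrightarrow> G = M"
  proof (rule predicate_Zorn)
    show "partial_order_on A (relation_of (\<lambda>x y. y \<subseteq> x) A)"
      by (rule partial_order_on_relation_ofI) auto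
    fix C assume "C \<in> Chains (relation_of (\<lambda>x y. y \<subseteq> x) A)"
    then have CA: "C \<subseteq> A" and chain: "subset.chain A C"
      unfolding Chains_def relation_of_def subset.chain_def by blast+
    show "\<exists>u\<in>A. \<forall>a\<in>C. u \<subseteq> a"
    proof (cases "C = {}")
      case True then show ?thesis using F A_def by blast
    next
      case False
      have "K \<inter> \<Inter>C \<noteq> {}"
      proof (rule compact_imp_fip[OF K])
        fix C' assume C': "finite C'" "C' \<subseteq> C"
        have KF: "K \<inter> F \<noteq> {}" using F by (rule face_Int_nonempty)
        show "K \<inter> \<Inter>C' \<noteq> {}"
        proof (cases "C' = {}")
          case False
          moreover have "subset.chain A C'"
            using C' chain unfolding subset.chain_def by blast
          ultimately have "\<Inter>C' \<in> C'"
            using Inter_in_chain C'(1) by blast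
          then have "face K (\<Inter>C')"
            using C'(2) CA unfolding A_def by blast
          then show ?thesis by (rule face_Int_nonempty)
        qed (use KF in auto)
      qed (use CA in \<open>auto simp: A_def face_def\<close>)
      then have "\<Inter>C \<noteq> {}" by (metis Int_empty_right)
      have faces: "face K G" if "G \<in> C" for G
        using that CA unfolding A_def by blast
      have "\<Inter>C \<subseteq> F" using CA False unfolding A_def by blast
      have "face K (\<Inter>C)"
        unfolding face_def
      proof (intro conjI ballI allI impI)
        show "\<Inter>C \<subseteq> K"
          using \<open>\<Inter>C \<subseteq> F\<close> F unfolding face_def by (metis order.trans)
        show "closed (\<Inter>C)"
          using faces by (intro closed_Inter ballI) (simp add: face_def)
        fix t t' r
        assume *: "t \<in> K" "t' \<in> K" "0 < r" "r < (1::real)"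
          "(\<lambda>x. r * t x + (1 - r) * t' x) \<in> \<Inter>C"
        have "t \<in> G \<and> t' \<in> G" if "G \<in> C" for G
          using faces[OF that] * InterD[OF *(5) that] unfolding face_def by metis
        then show "t \<in> \<Inter>C" "t' \<in> \<Inter>C" by (simp_all add: Inter_iff)
      qed (rule \<open>\<Inter>C \<noteq> {}\<close>)
      with \<open>\<Inter>C \<subseteq> F\<close> have "\<Inter>C \<in> A" unfolding A_def by (intro CollectI conjI)
      then show ?thesis by (intro bexI[of _ "\<Inter>C"] ballI Inter_lower)
    qed
  qed
  then obtain M where M: "M \<in> A" and min: "\<And>G. G \<in> A \<Longrightarrow> G \<subseteq> M \<Longrightarrow> G = M" by metis
  then have FM: "face K M" "M \<subseteq> F" unfolding A_def by simp_all
  moreover have "G = M" if "face K G" "G \<subseteq> M" for G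
    using min[OF _ that(2)] that FM(2) unfolding A_def by simp
  ultimately show thesis by (rule that)
qed

text \<open>Take a minimal face inside the set of maximisers. Each coordinate is continuous and
  affine, so its maximisers on that face form a face again; by minimality all coordinates are
  constant there and the face is a single extreme point.\<close>

lemma affine_attains_max_at_extreme_point:
  fixes K :: "('a \<Rightarrow> real) set"
  assumes K: "compact K" "K \<noteq> {}" and cont: "continuous_on K g" and aff: "affine_fun_on K g"
  obtains m where "m \<in> K" "\<And>t. t \<in> K \<Longrightarrow> g t \<le> g m"
    "\<And>t t' r. \<lbrakk>t \<in> K; t' \<in> K; 0 < r; r < 1; m = (\<lambda>x. r * t x + (1 - r) * t' x)\<rbrakk> \<Longrightarrow> t = m"
proof -
  have "closed K" by (rule compact_imp_closed_Hausdorff[OF Hausdorff_space_fun K(1)])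
  then have "face K K" using K(2) unfolding face_def by simp
  then have "face K {t \<in> K. \<forall>t'\<in>K. g t' \<le> g t}"
    by (rule face_argmax[OF K(1) _ cont aff])
  then obtain M where M: "face K M" "M \<subseteq> {t \<in> K. \<forall>t'\<in>K. g t' \<le> g t}"
    and min: "\<And>G. face K G \<Longrightarrow> G \<subseteq> M \<Longrightarrow> G = M"
    by (rule face_contains_minimal[OF K(1)]) (rule that)
  have "t x = t' x" if "t \<in> M" "t' \<in> M" for t t' x
  proof -
    have "face K {t \<in> M. \<forall>t'\<in>M. t' x \<le> t x}"
      by (rule face_argmax[OF K(1) M(1)])
        (auto simp: affine_fun_on_def intro: continuous_on_product_coordinates continuous_on_subset)
    then have "{t \<in> M. \<forall>t'\<in>M. t' x \<le> t x} = M" by (rule min) auto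
    then show ?thesis using that by (metis (mono_tags, lifting) mem_Collect_eq order.antisym)
  qed
  moreover obtain m where "m \<in> M" using M(1) by (auto simp: face_def)
  ultimately have single: "M = {m}" by blast
  show thesis
  proof
    show "m \<in> K" "\<And>t. t \<in> K \<Longrightarrow> g t \<le> g m" using M(2) single by auto
    show "t = m" if "t \<in> K" "t' \<in> K" "0 < r" "r < 1" "m = (\<lambda>x. r * t x + (1 - r) * t' x)" for t t' r
      using M(1) that unfolding single face_def by blast
  qed
qed

subsection \<open>The Hahn-Banach theorem\<close>

text \<open>Homogeneity is stated as an inequality for positive factors because this passes to
  infima; equality is recovered in \<open>sublinear_scale\<close>.\<close>

definition sublinear :: "('v::real_vector \<Rightarrow> real) \<Rightarrow> bool" where
  "sublinear q \<longleftrightarrow> (\<forall>x y. q (x + y) \<le> q x + q y) \<and> (\<forall>r x. 0 < r \<longrightarrow> q (r *\<^sub>R x) \<le> r * q x)"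

lemma sublinear_zero:
  assumes "sublinear q"
  shows "q 0 = 0"
proof -
  have "q (r *\<^sub>R 0) \<le> r * q 0" if "0 < r" for r
    using assms that unfolding sublinear_def by blast
  from this[of 2] this[of "1/2"] show ?thesis by simp
qed

lemma sublinear_scale:
  assumes q: "sublinear q" and "0 \<le> r"
  shows "q (r *\<^sub>R x) = r * q x"
proof (cases "r = 0")
  case True then show ?thesis using sublinear_zero[OF q] by simp
next
  case False
  with \<open>0 \<le> r\<close> have r: "0 < r" by simp
  have "r * q (inverse r *\<^sub>R r *\<^sub>R x) \<le> r * (inverse r * q (r *\<^sub>R x))"
    using q r by (intro mult_left_mono) (simp_all add: sublinear_def del: scaleR_scaleR)
  then show ?thesis using q r by (simp add: sublinear_def order.antisym field_simps)
qed

lemma sublinear_lower: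
  assumes "sublinear q"
  shows "- q (- x) \<le> q x"
proof -
  have "q (x + - x) \<le> q x + q (- x)"
    using assms unfolding sublinear_def by blast
  then show ?thesis using sublinear_zero[OF assms] by simp
qed

text \<open>For fixed \<open>y\<close> the infimum over \<open>t \<ge> 0\<close> of
  \<open>q (x + t *\<^sub>R y) - t * q y\<close> is a sublinear minorant of \<open>q\<close>, hence
  equal to \<open>q\<close>. Its bound at \<open>t = 1\<close> is the missing half of
  additivity.\<close>

lemma minimal_sublinear_linear:
  assumes q: "sublinear q" and min: "\<And>q'. sublinear q' \<Longrightarrow> (\<And>x. q' x \<le> q x) \<Longrightarrow> q' = q"
  shows "linear q"
proof -
  have add: "q (x + y) = q x + q y" for x y
  proof -
    define h where "h t x = q (x + t *\<^sub>R y) - t * q y" for t x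
    define q' where "q' x = (INF t\<in>{0..}. h t x)" for x
    have lower: "- q (- x) \<le> h t x" if "0 \<le> t" for t x
    proof -
      have "q ((x + t *\<^sub>R y) + - x) \<le> q (x + t *\<^sub>R y) + q (- x)"
        using q unfolding sublinear_def by blast
      then show ?thesis using sublinear_scale[OF q that] unfolding h_def by simp
    qed
    then have bdd: "bdd_below ((\<lambda>t. h t x) ` {0..})" for x
      by (intro bdd_belowI2[of _ "- q (- x)"]) auto
    have le_h: "q' x \<le> h t x" if "0 \<le> t" for t x
      unfolding q'_def using that bdd by (intro cINF_lower) auto
    have "sublinear q'"
      unfolding sublinear_def
    proof (intro conjI allI impI)
      fix x x'
      \<comment> \<open>The parameters \<open>t\<close> and \<open>t'\<close> are merged into
        \<open>t + t'\<close>, so two independent infima can be taken.\<close>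
      have "q' (x + x') \<le> h t x + h t' x'" if "0 \<le> t" "0 \<le> t'" for t t'
      proof -
        have "q' (x + x') \<le> h (t + t') (x + x')" using that by (intro le_h) simp
        also have "\<dots> \<le> h t x + h t' x'"
        proof -
          have "q ((x + t *\<^sub>R y) + (x' + t' *\<^sub>R y)) \<le> q (x + t *\<^sub>R y) + q (x' + t' *\<^sub>R y)"
            using q unfolding sublinear_def by blast
          then show ?thesis unfolding h_def by (simp add: algebra_simps)
        qed
        finally show ?thesis .
      qed
      then have "q' (x + x') - h t x \<le> h t' x'" if "0 \<le> t" "0 \<le> t'" for t t'
        using that by (fastforce simp: algebra_simps)
      then have "q' (x + x') - h t x \<le> q' x'" if "0 \<le> t" for t
        using that unfolding q'_def[of x'] by (intro cINF_greatest) auto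
      then have "q' (x + x') - q' x' \<le> h t x" if "0 \<le> t" for t
        using that by force
      then have "q' (x + x') - q' x' \<le> q' x"
        unfolding q'_def[of x] by (intro cINF_greatest) auto
      then show "q' (x + x') \<le> q' x + q' x'" by simp
    next
      fix r :: real and x assume r: "0 < r"
      have "q' (r *\<^sub>R x) / r \<le> h t x" if "0 \<le> t" for t
      proof -
        have "q' (r *\<^sub>R x) \<le> h (r * t) (r *\<^sub>R x)" using that r by (intro le_h) simp
        also have "\<dots> = q (r *\<^sub>R (x + t *\<^sub>R y)) - r * (t * q y)"
          unfolding h_def by (simp add: algebra_simps)
        also have "\<dots> = r * h t x"
          using sublinear_scale[OF q, of r] r unfolding h_def by (simp add: right_diff_distrib)
        finally show ?thesis using r by (simp add: field_simps)
      qed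
      then have "q' (r *\<^sub>R x) / r \<le> q' x"
        unfolding q'_def[of x] by (intro cINF_greatest) auto
      then show "q' (r *\<^sub>R x) \<le> r * q' x" using r by (simp add: field_simps)
    qed
    moreover have "q' x \<le> q x" for x
      using le_h[of 0 x] by (simp add: h_def)
    ultimately have "q' = q" by (rule min)
    then have "q x \<le> q (x + y) - q y"
      using le_h[of 1 x] by (simp add: h_def)
    moreover have "q (x + y) \<le> q x + q y"
      using q unfolding sublinear_def by blast
    ultimately show ?thesis by (simp add: order.antisym)
  qed
  have "q (r *\<^sub>R x) = r * q x" for r x
  proof (cases "0 \<le> r")
    case False
    then have "q (r *\<^sub>R x) = - q ((- r) *\<^sub>R x)"
      using add[of "r *\<^sub>R x" "(- r) *\<^sub>R x"] sublinear_zero[OF q] by simp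
    then show ?thesis using sublinear_scale[OF q, of "- r" x] False by simp
  qed (rule sublinear_scale[OF q])
  with add show ?thesis by (simp add: linear_iff)
qed

text \<open>Zorn's lemma provides a minimal sublinear functional below \<open>p\<close>. Extension
  from a subspace is obtained later by a suitable choice of \<open>p\<close>.\<close>

theorem hahn_banach:
  fixes p :: "'v::real_vector \<Rightarrow> real"
  assumes p: "sublinear p"
  obtains f where "linear f" "\<And>x. f x \<le> p x"
proof -
  define A where "A = {q. sublinear q \<and> (\<forall>x. q x \<le> p x)}"
  have "\<exists>q\<in>A. \<forall>q'\<in>A. q' \<le> q \<longrightarrow> q' = q"
  proof (rule predicate_Zorn)
    show "partial_order_on A (relation_of (\<lambda>x y. y \<le> x) A)"
      by (rule partial_order_on_relation_ofI) auto
    fix C assume "C \<in> Chains (relation_of (\<lambda>x y. y \<le> x) A)"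
    then have CA: "C \<subseteq> A" and chain: "\<And>q q'. q \<in> C \<Longrightarrow> q' \<in> C \<Longrightarrow> q \<le> q' \<or> q' \<le> q"
      unfolding Chains_def relation_of_def by blast+
    have CD: "sublinear q" "q x \<le> p x" if "q \<in> C" for q x
      using that CA by (auto simp: A_def)
    show "\<exists>u\<in>A. \<forall>q\<in>C. u \<le> q"
    proof (cases "C = {}")
      case True then show ?thesis using p A_def by blast
    next
      case False
      define u where "u x = (INF q\<in>C. q x)" for x
      have "- p (- x) \<le> q x" if "q \<in> C" for q x
        using sublinear_lower[OF CD(1)[OF that], of x] CD(2)[OF that, of "- x"] by linarith
      then have bdd: "bdd_below ((\<lambda>q. q x) ` C)" for x
        by (intro bdd_belowI2)
      have le: "u x \<le> q x" if "q \<in> C" for q x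
        unfolding u_def using that bdd by (intro cINF_lower)
      have "sublinear u"
        unfolding sublinear_def
      proof (intro conjI allI impI)
        fix x y
        \<comment> \<open>Two members of the chain have a common lower member \<open>k\<close>,
          whose subadditivity bounds the infimum.\<close>
        have "u (x + y) \<le> q x + q' y" if q: "q \<in> C" "q' \<in> C" for q q'
        proof -
          obtain k where k: "k \<in> C" "k \<le> q" "k \<le> q'" using chain[OF q] q by blast
          have "u (x + y) \<le> k (x + y)" by (rule le[OF k(1)])
          also have "\<dots> \<le> k x + k y" using CD(1)[OF k(1)] by (simp add: sublinear_def)
          also have "\<dots> \<le> q x + q' y" using k by (intro add_mono) (auto simp: le_fun_def)
          finally show ?thesis .
        qed
        then have "u (x + y) - q x \<le> q' y" if "q \<in> C" "q' \<in> C" for q q'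
          using that by (fastforce simp: algebra_simps)
        then have "u (x + y) - q x \<le> u y" if "q \<in> C" for q
          unfolding u_def[of y] using that False by (intro cINF_greatest) auto
        then have "u (x + y) - u y \<le> q x" if "q \<in> C" for q
          using that by force
        then have "u (x + y) - u y \<le> u x"
          unfolding u_def[of x] using False by (intro cINF_greatest) auto
        then show "u (x + y) \<le> u x + u y" by simp
      next
        fix r :: real and x assume r: "0 < r"
        have "u (r *\<^sub>R x) / r \<le> q x" if "q \<in> C" for q
          using le[OF that, of "r *\<^sub>R x"] CD(1)[OF that] r
          by (simp add: sublinear_scale field_simps)
        then have "u (r *\<^sub>R x) / r \<le> u x"
          unfolding u_def[of x] using False by (intro cINF_greatest)
        then show "u (r *\<^sub>R x) \<le> r * u x" using r by (simp add: field_simps)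
      qed
      moreover have "u x \<le> p x" for x
        using False le CD(2) by (meson ex_in_conv order.trans)
      ultimately have "u \<in> A" by (simp add: A_def)
      then show ?thesis using le by (auto simp: le_fun_def)
    qed
  qed
  then obtain q where q: "sublinear q" "\<And>x. q x \<le> p x"
    and min: "\<And>q'. q' \<in> A \<Longrightarrow> q' \<le> q \<Longrightarrow> q' = q"
    unfolding A_def by blast
  have "linear q"
    by (rule minimal_sublinear_linear[OF q(1)])
      (rule min, auto simp: A_def le_fun_def intro: order.trans[OF _ q(2)])
  then show thesis using that q(2) by blast
qed

subsection \<open>Representation of means on a compact space\<close>

text \<open>The disjoint compact sets \<open>K - U\<close> and \<open>K - V\<close> have disjoint
  open neighbourhoods; removing one neighbourhood at a time leaves two compact pieces covering
  \<open>K\<close>.\<close>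

lemma compact_subset_Un_split:
  fixes K :: "'b::topological_space set"
  assumes hausdorff: "Hausdorff_space (euclidean :: 'b topology)"
    and K: "compact K" and U: "open U" "open V" "K \<subseteq> U \<union> V"
  obtains L L' where "compact L" "compact L'" "L \<subseteq> U" "L' \<subseteq> V" "K = L \<union> L'"
proof -
  note hausdorff
  moreover have "compactin euclidean (K - U)" "compactin euclidean (K - V)"
    using K U by (simp_all add: compact_diff)
  moreover have "disjnt (K - U) (K - V)"
    using U(3) by (auto simp: disjnt_def)
  ultimately obtain P Q where PQ: "openin euclidean P" "openin euclidean Q" "K - U \<subseteq> P" "K - V \<subseteq> Q" "disjnt P Q"
    by (rule Hausdorff_space_compact_separation)
  show thesis
  proof
    show "compact (K - P)" "compact (K - Q)"
      using K PQ by (simp_all add: compact_diff)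
    show "K - P \<subseteq> U" "K - Q \<subseteq> V" "K = (K - P) \<union> (K - Q)"
      using PQ(3-5) by (auto simp: disjnt_def)
  qed
qed

text \<open>A mean \<open>J\<close> on \<open>W\<close> assigns a finitely additive charge \<open>m\<close> to \<^emph>\<open>all\<close> sets. The Borel measure
  representing \<open>J\<close> on continuous functions is the outer regular measure whose value on an open set
  is the supremum of \<open>m\<close> over its compact subsets.\<close>

locale compact_mean =
  fixes W :: "'b::topological_space set" and J :: "('b \<Rightarrow> real) \<Rightarrow> real"
  assumes hausdorff: "Hausdorff_space (euclidean :: 'b topology)"
    and compact_W: "compact W"
    and J_add: "\<And>f g. bounded (range f) \<Longrightarrow> bounded (range g) \<Longrightarrow> J (\<lambda>x. f x + g x) = J f + J g"
    and J_scale: "\<And>f c. bounded (range f) \<Longrightarrow> J (\<lambda>x. c * f x) = c * J f"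
    and J_nonpos: "\<And>f. bounded (range f) \<Longrightarrow> (\<And>x. x \<in> W \<Longrightarrow> f x \<le> 0) \<Longrightarrow> J f \<le> 0"
    and J_one: "J (\<lambda>_. 1) = 1"
begin

definition m :: "'b set \<Rightarrow> real" where "m A = J (indicator A)"

definition inner_m :: "'b set \<Rightarrow> ennreal" where
  "inner_m U = (SUP K\<in>{K. compact K \<and> K \<subseteq> U}. ennreal (m K))"

definition outer_m :: "'b set \<Rightarrow> ennreal" where
  "outer_m A = (INF U\<in>{U. open U \<and> A \<subseteq> U}. inner_m U)"

section \<open>Elementary properties of the mean and its charge\<close>

lemma J_diff:
  assumes "bounded (range f)" "bounded (range g)"
  shows "J (\<lambda>x. f x - g x) = J f - J g"
proof -
  have "bounded (range (\<lambda>x. - g x))"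
    using assms(2) by (simp add: bounded_minus_comp)
  then have "J (\<lambda>x. f x + - g x) = J f + J (\<lambda>x. - g x)"
    by (rule J_add[OF assms(1)])
  then show ?thesis using J_scale[OF assms(2), of "-1"] by simp
qed

lemma J_mono:
  assumes "bounded (range f)" "bounded (range g)" "\<And>x. x \<in> W \<Longrightarrow> f x \<le> g x"
  shows "J f \<le> J g"
proof -
  have "J (\<lambda>x. f x - g x) \<le> 0"
    using assms by (intro J_nonpos bounded_minus_comp) auto
  then show ?thesis using J_diff[OF assms(1,2)] by simp
qed

lemma bounded_indicator: "bounded (range (indicat_real A))"
  by (rule boundedI[of _ 1]) (auto simp: indicator_def)

lemma J_zero: "J (\<lambda>_. 0) = 0"
  using J_scale[of "\<lambda>_. 1" 0] by simp

lemma bounded_sum: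
  fixes f :: "'i \<Rightarrow> 'b \<Rightarrow> real"
  assumes "\<And>i. i \<in> I \<Longrightarrow> bounded (range (f i))"
  shows "bounded (range (\<lambda>x. \<Sum>i\<in>I. f i x))"
  using assms by (induction I rule: infinite_finite_induct) (auto intro: bounded_plus_comp)

lemma J_sum:
  assumes "\<And>i. i \<in> I \<Longrightarrow> bounded (range (f i))"
  shows "J (\<lambda>x. \<Sum>i\<in>I. f i x) = (\<Sum>i\<in>I. J (f i))"
proof (cases "finite I")
  case True
  then show ?thesis using assms
  proof induction
    case (insert i I)
    then show ?case using bounded_sum[of I f] by (simp add: J_add)
  qed (simp add: J_zero)
qed (simp add: J_zero)

text \<open>The charge lives on \<open>W\<close>, as positivity of \<open>J\<close> is tested
  there.\<close>

lemma m_mono: "A \<inter> W \<subseteq> B \<Longrightarrow> m A \<le> m B"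
  unfolding m_def by (intro J_mono bounded_indicator) (auto simp: indicator_def)

lemma m_empty: "m {} = 0"
proof -
  have "indicat_real {} = (\<lambda>_::'b. 0)" by (simp add: fun_eq_iff)
  then show ?thesis unfolding m_def using J_zero by simp
qed

lemma m_nonneg: "0 \<le> m A"
  using m_mono[of "{}" A] m_empty by simp

lemma m_disjoint_Un:
  assumes "A \<inter> B = {}"
  shows "m (A \<union> B) = m A + m B"
proof -
  have "indicat_real (A \<union> B) = (\<lambda>x. indicat_real A x + indicat_real B x)"
    using assms by (auto simp: indicator_def fun_eq_iff)
  then show ?thesis
    unfolding m_def using J_add[OF bounded_indicator bounded_indicator] by simp
qed

lemma m_Un_le: "m (A \<union> B) \<le> m A + m B"
  using m_disjoint_Un[of A "B - A"] m_mono[of "B - A" B] by auto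

lemma m_UNIV: "m UNIV = 1" and m_W: "m W = 1"
proof -
  show "m UNIV = 1" unfolding m_def using J_one by (simp add: indicator_def)
  then show "m W = 1" using m_mono[of W UNIV] m_mono[of UNIV W] by simp
qed

section \<open>Inner content of open sets and the induced outer measure\<close>

lemma m_le_inner: "compact K \<Longrightarrow> K \<subseteq> U \<Longrightarrow> ennreal (m K) \<le> inner_m U"
  unfolding inner_m_def by (intro SUP_upper) auto

lemma inner_mono: "U \<subseteq> V \<Longrightarrow> inner_m U \<le> inner_m V"
  unfolding inner_m_def by (intro SUP_subset_mono) auto

lemma inner_le_1: "inner_m U \<le> 1"
  unfolding inner_m_def using m_mono[of _ UNIV] m_UNIV by (intro SUP_least) (auto simp: ennreal_le_1)

lemma outer_open: "open U \<Longrightarrow> outer_m U = inner_m U"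
  unfolding outer_m_def by (intro antisym INF_lower INF_greatest inner_mono) auto

lemma outer_mono: "A \<subseteq> B \<Longrightarrow> outer_m A \<le> outer_m B"
  unfolding outer_m_def by (intro INF_superset_mono) auto

lemma outer_le_inner: "open U \<Longrightarrow> A \<subseteq> U \<Longrightarrow> outer_m A \<le> inner_m U"
  unfolding outer_m_def by (intro INF_lower) auto

lemma outer_empty: "outer_m {} = 0"
  by (simp add: outer_open inner_m_def m_empty cong: conj_cong)

lemma m_le_sum_inner:
  assumes "compact K" "\<And>i. open (U i)" "K \<subseteq> (\<Union>i<n. U i)"
  shows "ennreal (m K) \<le> (\<Sum>i<n::nat. inner_m (U i))"
  using assms(1,3)
proof (induction n arbitrary: K)
  case 0
  then show ?case by (simp add: m_empty)
next
  case (Suc n)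
  have "open (\<Union>i<n. U i)" "K \<subseteq> (\<Union>i<n. U i) \<union> U n"
    using assms(2) Suc.prems(2) by (auto simp: lessThan_Suc)
  then obtain L L' where L: "compact L" "compact L'" "L \<subseteq> (\<Union>i<n. U i)" "L' \<subseteq> U n" "K = L \<union> L'"
    using compact_subset_Un_split[OF hausdorff Suc.prems(1) _ assms(2)] by metis
  have "ennreal (m K) \<le> ennreal (m L + m L')"
    unfolding L(5) by (intro ennreal_leI m_Un_le)
  also have "\<dots> = ennreal (m L) + ennreal (m L')"
    by (simp add: m_nonneg)
  also have "\<dots> \<le> (\<Sum>i<n. inner_m (U i)) + inner_m (U n)"
    by (intro add_mono Suc.IH m_le_inner L)
  finally show ?case by simp
qed

text \<open>A compact subset of the union is covered by finitely many of the sets, which reduces the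
  claim to \<open>m_le_sum_inner\<close>.\<close>

lemma inner_UN_le:
  assumes "\<And>i::nat. open (U i)"
  shows "inner_m (\<Union>i. U i) \<le> (\<Sum>i. inner_m (U i))"
  unfolding inner_m_def[of "\<Union>i. U i"]
proof (rule SUP_least, clarify)
  fix K assume K: "compact K" "K \<subseteq> (\<Union>i. U i)"
  then obtain I where I: "finite I" "K \<subseteq> (\<Union>i\<in>I. U i)"
    using compactE_image[of K UNIV U] assms by metis
  obtain n where "I \<subseteq> {..<n}" using I(1) finite_nat_iff_bounded by blast
  with I(2) have "K \<subseteq> (\<Union>i<n. U i)" by blast
  then have "ennreal (m K) \<le> (\<Sum>i<n. inner_m (U i))"
    by (intro m_le_sum_inner K assms)
  also have "\<dots> \<le> (\<Sum>i. inner_m (U i))"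
    by (intro sum_le_suminf) auto
  finally show "ennreal (m K) \<le> (\<Sum>i. inner_m (U i))" .
qed

lemma countably_subadditive_outer: "countably_subadditive UNIV outer_m"
  unfolding countably_subadditive_def
proof (intro allI impI)
  fix A :: "nat \<Rightarrow> 'b set"
  show "outer_m (\<Union>i. A i) \<le> (\<Sum>i. outer_m (A i))"
  proof (rule ennreal_le_epsilon)
    fix e :: real assume "0 < e" "(\<Sum>n. outer_m (A n)) < top"
    \<comment> \<open>Finiteness of the sum makes every term finite, so adding a positive amount is
      a strict increase and an approximating open set exists.\<close>
    then have *: "\<And>n. outer_m (A n) < outer_m (A n) + e * (1/2)^Suc n"
      by (auto simp add: less_top dest!: ennreal_suminf_lessD)
    have "\<exists>U. open U \<and> A n \<subseteq> U \<and> inner_m U \<le> outer_m (A n) + e * (1/2)^Suc n" for n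
      using *[of n] unfolding outer_m_def[of "A n"] INF_less_iff by (auto intro: less_imp_le)
    then obtain U where U: "\<And>n. open (U n)" "\<And>n. A n \<subseteq> U n"
        "\<And>n. inner_m (U n) \<le> outer_m (A n) + e * (1/2)^Suc n"
      by metis
    have "outer_m (\<Union>i. A i) \<le> inner_m (\<Union>i. U i)"
      using U(1,2) by (intro outer_le_inner) auto
    also have "\<dots> \<le> (\<Sum>n. inner_m (U n))"
      by (rule inner_UN_le[OF U(1)])
    also have "\<dots> \<le> (\<Sum>n. outer_m (A n) + e * (1/2) ^ Suc n)"
      by (intro suminf_le U) auto
    also have "... = (\<Sum>n. outer_m (A n)) + (\<Sum>n. ennreal e * ennreal ((1/2) ^ Suc n))"
      using \<open>0 < e\<close> by (subst suminf_add[symmetric])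
        (auto simp del: ennreal_suminf_cmult simp add: ennreal_mult[symmetric])
    also have "\<dots> = (\<Sum>n. outer_m (A n)) + e"
      unfolding ennreal_suminf_cmult
      by (subst suminf_ennreal_eq[OF zero_le_power power_half_series]) auto
    finally show "outer_m (\<Union>i. A i) \<le> (\<Sum>n. outer_m (A n)) + e" .
  qed
qed

lemma outer_measure_space_outer: "outer_measure_space UNIV outer_m"
  unfolding outer_measure_space_def positive_def increasing_def
  using outer_empty outer_mono countably_subadditive_outer by auto

lemma outer_Un_le: "A \<inter> B = {} \<Longrightarrow> outer_m (A \<union> B) \<le> outer_m A + outer_m B"
  using ring_of_sets.countably_subadditive_subadditive[OF ring_of_sets_Pow, of UNIV outer_m]
    outer_measure_space_outer
  unfolding outer_measure_space_def by (simp add: subadditive_def)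

text \<open>For compact \<open>K\<close> inside \<open>V \<inter> U\<close>, the open set
  \<open>V - K\<close> contains \<open>V - U\<close>, and its compact subsets are disjoint from
  \<open>K\<close>. There the charge is additive.\<close>

lemma inner_split:
  assumes "open U" "open V"
  shows "inner_m (V \<inter> U) + outer_m (V - U) \<le> inner_m V"
proof -
  have "ennreal (m K) + outer_m (V - U) \<le> inner_m V" if K: "compact K" "K \<subseteq> V \<inter> U" for K
  proof -
    have "open (V - K)" using assms K compact_imp_closed_Hausdorff[OF hausdorff] by blast
    then have "outer_m (V - U) \<le> inner_m (V - K)"
      using K by (intro outer_le_inner) auto
    then have "ennreal (m K) + outer_m (V - U) \<le> ennreal (m K) + inner_m (V - K)"
      by (rule add_left_mono)
    also have "\<dots> = (SUP L\<in>{L. compact L \<and> L \<subseteq> V - K}. ennreal (m K) + ennreal (m L))"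
      unfolding inner_m_def by (rule ennreal_SUP_add_right) auto
    also have "\<dots> \<le> inner_m V"
    proof (rule SUP_least, clarify)
      fix L assume L: "compact L" "L \<subseteq> V - K"
      have "ennreal (m K) + ennreal (m L) = ennreal (m (K \<union> L))"
        using L(2) by (subst m_disjoint_Un) (auto simp: m_nonneg)
      also have "\<dots> \<le> inner_m V"
        using K L by (intro m_le_inner compact_Un) auto
      finally show "ennreal (m K) + ennreal (m L) \<le> inner_m V" .
    qed
    finally show ?thesis .
  qed
  moreover have "inner_m (V \<inter> U) + outer_m (V - U)
      = (SUP K\<in>{K. compact K \<and> K \<subseteq> V \<inter> U}. ennreal (m K) + outer_m (V - U))"
    unfolding inner_m_def by (rule ennreal_SUP_add_left[symmetric]) auto
  ultimately show ?thesis by (auto intro: SUP_least)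
qed

text \<open>Caratheodory's condition for arbitrary \<open>A\<close> follows from
  \<open>inner_split\<close> by taking the infimum over open \<open>V\<close> containing
  \<open>A\<close>.\<close>

lemma open_in_lambda_system:
  assumes U: "open U"
  shows "U \<in> lambda_system UNIV UNIV outer_m"
proof -
  have "outer_m (U \<inter> A) + outer_m ((UNIV - U) \<inter> A) = outer_m A" for A
  proof (rule antisym)
    show "outer_m A \<le> outer_m (U \<inter> A) + outer_m ((UNIV - U) \<inter> A)"
      using outer_Un_le[of "U \<inter> A" "(UNIV - U) \<inter> A"] by (simp add: Int_Un_distrib2[symmetric] Int_assoc Diff_Int_distrib2)
    show "outer_m (U \<inter> A) + outer_m ((UNIV - U) \<inter> A) \<le> outer_m A"
      unfolding outer_m_def[of A]
    proof (rule INF_greatest, clarify)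
      fix V assume V: "open V" "A \<subseteq> V"
      have "outer_m (U \<inter> A) + outer_m ((UNIV - U) \<inter> A) \<le> inner_m (V \<inter> U) + outer_m (V - U)"
        using U V by (intro add_mono outer_le_inner outer_mono) auto
      also have "\<dots> \<le> inner_m V" by (rule inner_split[OF U V(1)])
      finally show "outer_m (U \<inter> A) + outer_m ((UNIV - U) \<inter> A) \<le> inner_m V" .
    qed
  qed
  then show ?thesis by (simp add: lambda_system_def)
qed

definition M :: "'b measure" where "M = measure_of UNIV (sets borel) outer_m"

lemma sets_M: "sets M = sets borel"
  unfolding M_def using sets.sigma_sets_eq[of borel] by simp

lemma space_M: "space M = UNIV"
  unfolding M_def by (simp add: space_measure_of_conv)

lemma measure_space_outer: "measure_space UNIV (sets borel) outer_m"
proof -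
  let ?L = "lambda_system UNIV UNIV outer_m"
  have "sigma_algebra UNIV (UNIV :: 'b set set)"
    using sigma_algebra_Pow[of "UNIV :: 'b set"] by simp
  then have L: "measure_space UNIV ?L outer_m"
    using sigma_algebra.caratheodory_lemma outer_measure_space_outer by blast
  have sub: "sets borel \<subseteq> ?L"
    unfolding sets_borel
    by (rule sigma_algebra.sigma_sets_subset)
      (use L open_in_lambda_system in \<open>auto simp: measure_space_def\<close>)
  have "sigma_algebra UNIV (sets (borel :: 'b measure))"
    using sets.sigma_algebra_axioms[of "borel :: 'b measure"] by simp
  from measure_down[OF L this sub] show ?thesis .
qed

lemma emeasure_M: "A \<in> sets borel \<Longrightarrow> emeasure M A = outer_m A"
  unfolding M_def using measure_space_outer
  by (intro emeasure_measure_of_sigma) (auto simp: measure_space_def)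

text \<open>Cutting with \<open>W\<close> keeps the charge and makes the closed set compact, so it
  competes in the inner content of every open superset.\<close>

lemma m_le_outer_closed:
  assumes "closed K"
  shows "ennreal (m K) \<le> outer_m K"
  unfolding outer_m_def
proof (rule INF_greatest, clarify)
  fix V assume V: "open V" "K \<subseteq> V"
  have "ennreal (m K) \<le> ennreal (m (W \<inter> K))"
    by (intro ennreal_leI m_mono) auto
  also have "\<dots> \<le> inner_m V"
    using V assms compact_W by (intro m_le_inner compact_Int_closed) auto
  finally show "ennreal (m K) \<le> inner_m V" .
qed

lemma prob_space_M: "prob_space M"
proof
  have "ennreal (m W) \<le> inner_m UNIV" by (rule m_le_inner[OF compact_W]) simp
  then have "inner_m UNIV = 1"
    using inner_le_1[of UNIV] m_W by (intro antisym) simp_all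
  then show "emeasure M (space M) = 1"
    by (simp add: space_M emeasure_M outer_open)
qed

sublocale M: prob_space M by (rule prob_space_M)

lemma m_le_measure: "closed K \<Longrightarrow> m K \<le> measure M K"
  using m_le_outer_closed[of K] emeasure_M[of K] M.emeasure_eq_measure[of K]
    ennreal_le_iff[OF measure_nonneg, of "m K" M K] by simp

lemma closed_W: "closed W"
  by (rule compact_imp_closed_Hausdorff[OF hausdorff compact_W])

lemma measure_W: "measure M W = 1"
  using m_le_measure[OF closed_W] m_W M.prob_le_1[of W] by simp

text \<open>The sum counts the thresholds \<open>k / n\<close> not exceeding \<open>y\<close>; the
  bound \<open>y \<le> 1\<close> keeps all of them within \<open>1..n\<close>.\<close>

lemma layer_sum:
  fixes y :: real
  assumes "0 \<le> y" "y \<le> 1" "0 < n"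
  shows "(\<Sum>k\<in>{1..n}. indicat_real {real k / real n..} y) = of_int \<lfloor>real n * y\<rfloor>"
proof -
  have "{k \<in> {1..n}. real k / real n \<le> y} = {1..nat \<lfloor>real n * y\<rfloor>}"
  proof (intro equalityI subsetI)
    fix k assume "k \<in> {k \<in> {1..n}. real k / real n \<le> y}"
    then show "k \<in> {1..nat \<lfloor>real n * y\<rfloor>}"
      using assms by (auto simp: le_nat_iff le_floor_iff field_simps)
  next
    fix k assume k: "k \<in> {1..nat \<lfloor>real n * y\<rfloor>}"
    then have "real k \<le> real n * y"
      using assms by (auto simp: le_nat_iff le_floor_iff)
    moreover have "real n * y \<le> real n"
      using assms by (simp add: mult_left_le)
    ultimately have "real k \<le> real n" "real k / real n \<le> y"
      using assms(3) by (linarith, simp add: field_simps)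
    then show "k \<in> {k \<in> {1..n}. real k / real n \<le> y}"
      using k by auto
  qed
  moreover have "(\<Sum>k\<in>{1..n}. indicat_real {real k / real n..} y) = real (card {k \<in> {1..n}. real k / real n \<le> y})"
    by (simp add: indicator_def sum.If_cases Int_def)
  ultimately show ?thesis using assms by simp
qed

lemma integrable_indicator:
  assumes "continuous_on W f" "\<And>x. x \<in> W \<Longrightarrow> 0 \<le> f x" "\<And>x. x \<in> W \<Longrightarrow> f x \<le> (1::real)"
  shows "integrable M (\<lambda>x. indicator W x * f x)"
proof (rule M.integrable_const_bound)
  show "AE x in M. norm (indicator W x * f x) \<le> 1"
    using assms(2,3) by (intro AE_I2) (auto simp: indicator_def)
  show "(\<lambda>x. indicator W x * f x) \<in> borel_measurable M"
    using borel_measurable_continuous_on_indicator[OF _ assms(1)] closed_W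
    by (simp add: measurable_cong_sets[OF sets_M refl])
qed

text \<open>A layer-cake sum over the closed superlevel sets \<open>S k\<close> approximates
  \<open>f\<close> on \<open>W\<close> from below within \<open>1 / n\<close>. On closed sets the
  charge is at most the measure, and the error vanishes as \<open>n\<close> grows.\<close>

lemma J_le_integral:
  assumes f: "bounded (range f)" "continuous_on W f" "\<And>x. x \<in> W \<Longrightarrow> 0 \<le> f x" "\<And>x. x \<in> W \<Longrightarrow> f x \<le> 1"
  shows "J f \<le> (\<integral>x. indicator W x * f x \<partial>M)"
proof -
  have int: "integrable M (\<lambda>x. indicator W x * f x)"
    using f(2-4) by (rule integrable_indicator)
  have bound: "J f \<le> (\<integral>x. indicator W x * f x \<partial>M) + 1 / real n" if n: "0 < n" for n
  proof -
    define S where "S k = {x \<in> W. real k / real n \<le> f x}" for k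
    have S: "closed (S k)" for k
      unfolding S_def using continuous_closed_preimage[OF f(2) closed_W closed_atLeast, of "real k / real n"]
      by (simp add: vimage_def Int_def)
    then have S_sets[measurable]: "S k \<in> sets M" for k by (simp add: sets_M)
    define h where "h x = (\<Sum>k\<in>{1..n}. indicat_real (S k) x) / real n" for x
    have h: "h x = of_int \<lfloor>real n * f x\<rfloor> / real n" if "x \<in> W" for x
    proof -
      have "indicat_real (S k) x = indicat_real {real k / real n..} (f x)" for k
        using that by (auto simp: S_def indicator_def)
      then show ?thesis unfolding h_def using layer_sum[OF f(3,4)[OF that] n] by simp
    qed
    have lower: "h x \<le> f x" and upper: "f x \<le> h x + 1 / real n" if "x \<in> W" for x
    proof -
      have *: "real n * h x = of_int \<lfloor>real n * f x\<rfloor>" using h[OF that] n by simp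
      then have "real n * h x \<le> real n * f x" by linarith
      then show "h x \<le> f x" using n by simp
      have "real n * f x \<le> real n * h x + 1" unfolding * by linarith
      then show "f x \<le> h x + 1 / real n" using n by (simp add: field_simps)
    qed
    have bounded_h: "bounded (range (\<lambda>x. \<Sum>k\<in>{1..n}. indicat_real (S k) x))"
      by (intro bounded_sum bounded_indicator)
    have const: "bounded (range (\<lambda>x::'b. 1::real))" by simp
    have bounded_h': "bounded (range (\<lambda>x. (1 / real n) * (\<Sum>k\<in>{1..n}. indicat_real (S k) x)))"
      using bounded_scaleR_comp[OF bounded_h, of "1 / real n"] by simp
    have "J f \<le> J (\<lambda>x. (1 / real n) * (\<Sum>k\<in>{1..n}. indicat_real (S k) x) + (1 / real n) * 1)"
      using upper unfolding h_def
      by (intro J_mono f(1) bounded_plus_comp bounded_h') auto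
    also have "\<dots> = (1 / real n) * J (\<lambda>x. \<Sum>k\<in>{1..n}. indicat_real (S k) x) + (1 / real n) * J (\<lambda>x. 1)"
      by (subst J_add[OF bounded_h'], simp, simp only: J_scale[OF bounded_h] J_scale[OF const])
    also have "\<dots> = (\<Sum>k\<in>{1..n}. m (S k)) / real n + 1 / real n"
      by (simp add: J_sum[OF bounded_indicator] m_def J_one)
    also have "\<dots> \<le> (\<Sum>k\<in>{1..n}. measure M (S k)) / real n + 1 / real n"
      by (intro add_right_mono divide_right_mono sum_mono m_le_measure S) simp
    also have "(\<Sum>k\<in>{1..n}. measure M (S k)) / real n = (\<integral>x. h x \<partial>M)"
      unfolding h_def by (simp add: M.emeasure_eq_measure)
    also have "\<dots> \<le> (\<integral>x. indicator W x * f x \<partial>M)"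
    proof (rule integral_mono[OF _ int])
      show "integrable M h" unfolding h_def by (simp add: M.emeasure_eq_measure)
      have "h x = 0" if "x \<notin> W" for x
        using that unfolding h_def S_def by simp
      with lower show "h x \<le> indicator W x * f x" for x
        by (auto simp: indicator_def)
    qed
    finally show ?thesis by simp
  qed
  have "(\<lambda>n. (\<integral>x. indicator W x * f x \<partial>M) + 1 / real n) \<longlonglongrightarrow> (\<integral>x. indicator W x * f x \<partial>M) + 0"
    by (intro tendsto_intros lim_1_over_n)
  then have "J f \<le> (\<integral>x. indicator W x * f x \<partial>M) + 0"
    by (rule LIMSEQ_le_const) (rule exI[of _ 1], intro allI impI bound, linarith)
  then show ?thesis by simp
qed

text \<open>The reverse inequality is \<open>J_le_integral\<close> for \<open>1 - f\<close>, because
  \<open>J\<close> and the measure both give total mass 1.\<close>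

lemma J_eq_integral:
  assumes f: "bounded (range f)" "continuous_on W f" "\<And>x. x \<in> W \<Longrightarrow> 0 \<le> f x" "\<And>x. x \<in> W \<Longrightarrow> f x \<le> 1"
  shows "integrable M (\<lambda>x. indicator W x * f x)" "J f = (\<integral>x. indicator W x * f x \<partial>M)"
proof -
  show int: "integrable M (\<lambda>x. indicator W x * f x)"
    using f(2-4) by (rule integrable_indicator)
  have W[measurable]: "W \<in> sets M" using closed_W by (simp add: sets_M)
  have const: "bounded (range (\<lambda>x::'b. 1::real))" by simp
  have "1 - J f = J (\<lambda>x. 1 - f x)"
    using J_diff[OF const f(1)] J_one by simp
  also have "\<dots> \<le> (\<integral>x. indicator W x * (1 - f x) \<partial>M)"
    using f by (intro J_le_integral bounded_minus_comp const continuous_intros) auto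
  also have "\<dots> = (\<integral>x. indicator W x - indicator W x * f x \<partial>M)"
    by (simp add: algebra_simps)
  also have "\<dots> = 1 - (\<integral>x. indicator W x * f x \<partial>M)"
    by (subst Bochner_Integration.integral_diff[OF _ int])
      (simp_all add: M.emeasure_eq_measure measure_W)
  finally show "J f = (\<integral>x. indicator W x * f x \<partial>M)"
    using J_le_integral[OF f] by simp
qed

end

subsection \<open>Extension of a point evaluation to a mean\<close>

text \<open>Over the discrete topology, bounded continuous functions are arbitrary bounded functions.\<close>

definition bfun :: "('b \<Rightarrow> real) \<Rightarrow> ('b discrete \<Rightarrow>\<^sub>C real)" where
  "bfun f = Bcontfun (\<lambda>x. f (of_discrete x))"

definition at_point :: "('b discrete \<Rightarrow>\<^sub>C real) \<Rightarrow> 'b \<Rightarrow> real" where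
  "at_point f x = apply_bcontfun f (discrete x)"

lemma at_point_simps [simp]:
  "at_point (f + g) x = at_point f x + at_point g x"
  "at_point (f - g) x = at_point f x - at_point g x"
  "at_point (- f) x = - at_point f x"
  "at_point (r *\<^sub>R f) x = r * at_point f x"
  "at_point 0 x = 0"
  by (simp_all add: at_point_def)

lemma at_point_bfun:
  assumes "bounded (range f)"
  shows "at_point (bfun f) x = f x"
proof -
  have "bounded (range (\<lambda>x. f (of_discrete x)))"
    by (rule bounded_subset[OF assms]) auto
  moreover have "continuous_on UNIV (\<lambda>x. f (of_discrete x))"
    by (simp add: continuous_on_open_vimage open_discrete)
  ultimately show ?thesis
    unfolding bfun_def at_point_def by (simp add: Bcontfun_inverse bcontfun_def discrete_inverse)
qed

lemma bfun_eqI: "(\<And>x. at_point f x = at_point g x) \<Longrightarrow> f = g"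
  unfolding at_point_def by (rule bcontfun_eqI) (metis of_discrete_inverse)

lemma abs_at_point_le: "\<bar>at_point f x\<bar> \<le> norm f"
  unfolding at_point_def using norm_bounded[of f "discrete x"] by simp

text \<open>Let \<open>p f\<close> be the infimum of the values at \<open>s\<close> of those members
  of \<open>G\<close> that dominate \<open>f\<close> on \<open>W\<close>; \<open>e\<close> makes it
  finite. A linear functional below \<open>p\<close> is nonpositive when 0 dominates
  \<open>f\<close>, and testing it on \<open>g\<close> and \<open>- g\<close> shows that it is
  evaluation at \<open>s\<close> on \<open>G\<close>.\<close>

lemma point_evaluation_extends:
  fixes G :: "('b discrete \<Rightarrow>\<^sub>C real) set"
  assumes G: "subspace G"
    and e: "e \<in> G" "at_point e s = 1" "\<And>x. x \<in> W \<Longrightarrow> at_point e x = 1"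
    and pos: "\<And>g. g \<in> G \<Longrightarrow> (\<And>x. x \<in> W \<Longrightarrow> 0 \<le> at_point g x) \<Longrightarrow> 0 \<le> at_point g s"
  obtains I where "linear I" "\<And>g. g \<in> G \<Longrightarrow> I g = at_point g s"
    "\<And>f. (\<forall>x\<in>W. at_point f x \<le> 0) \<Longrightarrow> I f \<le> (0::real)"
proof -
  define D where "D f = {g \<in> G. \<forall>x\<in>W. at_point f x \<le> at_point g x}" for f
  define p where "p f = (INF g\<in>D f. at_point g s)" for f
  have nonempty: "D f \<noteq> {}" for f
  proof -
    have "norm f *\<^sub>R e \<in> D f"
      unfolding D_def using e(1,3) subspace_scale[OF G] abs_at_point_le[of f] by (auto simp: abs_le_iff)
    then show ?thesis by blast
  qed
  have "- norm f \<le> at_point g s" if "g \<in> D f" for f g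
  proof -
    have "0 \<le> at_point (g + norm f *\<^sub>R e) s"
    proof (rule pos)
      show "g + norm f *\<^sub>R e \<in> G"
        using that e(1) G by (simp add: D_def subspace_add subspace_scale)
      show "0 \<le> at_point (g + norm f *\<^sub>R e) x" if "x \<in> W" for x
        using \<open>g \<in> D f\<close> that abs_at_point_le[of f x] e(3)[OF that] by (fastforce simp: D_def)
    qed
    then show ?thesis using e(2) by simp
  qed
  then have bdd: "bdd_below ((\<lambda>g. at_point g s) ` D f)" for f
    by (intro bdd_belowI2)
  have le: "p f \<le> at_point g s" if "g \<in> D f" for f g
    unfolding p_def by (rule cINF_lower[OF bdd that])
  have "sublinear p"
    unfolding sublinear_def
  proof (intro conjI allI impI)
    fix f f'
    have *: "p (f + f') \<le> at_point g s + at_point g' s" if "g \<in> D f" "g' \<in> D f'" for g g'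
    proof -
      have "g + g' \<in> D (f + f')"
        using that G by (auto simp: D_def subspace_add intro: add_mono)
      from le[OF this] show ?thesis by simp
    qed
    have "p (f + f') - at_point g s \<le> p f'" if "g \<in> D f" for g
      unfolding p_def[of f']
    proof (rule cINF_greatest[OF nonempty])
      show "p (f + f') - at_point g s \<le> at_point g' s" if "g' \<in> D f'" for g'
        using *[OF \<open>g \<in> D f\<close> that] by linarith
    qed
    then have **: "p (f + f') - p f' \<le> at_point g s" if "g \<in> D f" for g
      using that by force
    have "p (f + f') - p f' \<le> p f"
      unfolding p_def[of f] by (rule cINF_greatest[OF nonempty **])
    then show "p (f + f') \<le> p f + p f'" by linarith
  next
    fix r :: real and f assume r: "0 < r"
    have "p (r *\<^sub>R f) / r \<le> p f"
      unfolding p_def[of f]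
    proof (rule cINF_greatest[OF nonempty])
      fix g assume "g \<in> D f"
      then have "r *\<^sub>R g \<in> D (r *\<^sub>R f)"
        using r G by (auto simp: D_def subspace_scale)
      from le[OF this] r show "p (r *\<^sub>R f) / r \<le> at_point g s" by (simp add: field_simps)
    qed
    then show "p (r *\<^sub>R f) \<le> r * p f" using r by (simp add: field_simps)
  qed
  then obtain I where I: "linear I" "\<And>f. I f \<le> p f" by (rule hahn_banach) (rule that)
  show thesis
  proof
    show "linear I" by (rule I(1))
    show "I f \<le> 0" if "\<forall>x\<in>W. at_point f x \<le> 0" for f
    proof -
      have "0 \<in> D f" using that subspace_0[OF G] by (simp add: D_def)
      from order.trans[OF I(2) le[OF this]] show ?thesis by simp
    qed
    show "I g = at_point g s" if "g \<in> G" for g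
    proof (rule antisym)
      have le_eval: "I h \<le> at_point h s" if "h \<in> G" for h
        using order.trans[OF I(2) le] that by (simp add: D_def)
      show "I g \<le> at_point g s" by (rule le_eval[OF that])
      show "at_point g s \<le> I g"
        using le_eval[OF subspace_neg[OF G that]] linear_neg[OF I(1), of g] by simp
    qed
  qed
qed

lemma (in compact_mean) representing_measure:
  obtains \<mu> :: "'b measure" where "sets \<mu> = (\<inter>) W ` sets borel" "prob_space \<mu>"
    "\<And>f. \<lbrakk>bounded (range f); continuous_on W f; \<forall>x\<in>W. f x \<in> {0..1}\<rbrakk>
      \<Longrightarrow> integrable \<mu> f \<and> J f = (\<integral>x. f x \<partial>\<mu>)"
proof
  have W_sets: "W \<inter> space M \<in> sets M"
    using closed_W by (simp add: space_M sets_M)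
  show "sets (restrict_space M W) = (\<inter>) W ` sets borel"
    by (simp add: sets_restrict_space sets_M)
  show "prob_space (restrict_space M W)"
    using measure_W W_sets
    by (intro prob_spaceI) (simp add: emeasure_restrict_space space_restrict_space space_M M.emeasure_eq_measure)
  show "integrable (restrict_space M W) f \<and> J f = (\<integral>x. f x \<partial>restrict_space M W)"
    if "bounded (range f)" "continuous_on W f" "\<forall>x\<in>W. f x \<in> {0..1}" for f
    using J_eq_integral[of f] that by (simp add: integrable_restrict_space[OF W_sets] integral_restrict_space[OF W_sets])
qed

lemma compact_mean_functional:
  fixes I :: "('b::topological_space discrete \<Rightarrow>\<^sub>C real) \<Rightarrow> real"
  assumes "Hausdorff_space (euclidean :: 'b topology)" "compact W"
    and I: "linear I" and nonpos: "\<And>f. (\<forall>x\<in>W. at_point f x \<le> 0) \<Longrightarrow> I f \<le> 0"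
    and one: "I (bfun (\<lambda>_. 1)) = 1"
  shows "compact_mean W (\<lambda>f. I (bfun f))"
proof
  show "I (bfun (\<lambda>x. f x + g x)) = I (bfun f) + I (bfun g)"
    if "bounded (range f)" "bounded (range g)" for f g
  proof -
    have "bfun (\<lambda>x. f x + g x) = bfun f + bfun g"
      by (rule bfun_eqI) (simp add: at_point_bfun that bounded_plus_comp)
    then show ?thesis by (simp add: linear_add[OF I])
  qed
  show "I (bfun (\<lambda>x. c * f x)) = c * I (bfun f)" if f: "bounded (range f)" for f c
  proof -
    have "bounded (range (\<lambda>x. c * f x))"
      using bounded_scaleR_comp[OF f, of c] by simp
    then have "bfun (\<lambda>x. c * f x) = c *\<^sub>R bfun f"
      by (intro bfun_eqI) (simp add: at_point_bfun f)
    then show ?thesis by (simp add: linear_scale[OF I])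
  qed
  show "I (bfun f) \<le> 0" if "bounded (range f)" "\<And>x. x \<in> W \<Longrightarrow> f x \<le> 0" for f
    by (rule nonpos) (simp add: at_point_bfun that)
qed (rule assms)+

subsection \<open>The spaces of Bosbach states and of state-morphisms\<close>

lemma compact_unit_cube: "compact {t :: 'a \<Rightarrow> real. \<forall>x. t x \<in> {0..1}}"
proof -
  have "compactin (product_topology (\<lambda>_::'a. euclidean) UNIV) (PiE UNIV (\<lambda>_. {0..1::real}))"
    by (simp add: compactin_PiE)
  then show ?thesis by (simp add: euclidean_product_topology PiE_UNIV_domain Pi_def)
qed

lemma compact_bosbach_states: "compact {t. bosbach_state imp imp' one zero t}"
proof -
  have "closed {t :: 'a \<Rightarrow> real. (\<forall>x y. t x + t (imp x y) = t y + t (imp y x)) \<and>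
      (\<forall>x y. t x + t (imp' x y) = t y + t (imp' y x)) \<and> t zero = 0 \<and> t one = 1}"
    by (intro closed_Collect_conj closed_Collect_all closed_Collect_eq continuous_intros
        continuous_on_product_coordinates)
  from compact_Int_closed[OF compact_unit_cube this] show ?thesis
    by (rule back_subst[of compact]) (auto simp: bosbach_state_def)
qed

lemma compact_state_morphisms: "compact (state_morphisms imp imp' zero)"
proof -
  have "closed {t :: 'a \<Rightarrow> real. t zero = 0 \<and> (\<forall>x y. t (imp x y) = min (1 - t x + t y) 1) \<and>
      (\<forall>x y. t (imp' x y) = min (1 - t x + t y) 1)}"
    by (intro closed_Collect_conj closed_Collect_all closed_Collect_eq continuous_intros
        continuous_on_product_coordinates)
  from compact_Int_closed[OF compact_unit_cube this] show ?thesis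
    by (rule back_subst[of compact]) (auto simp: state_morphisms_def)
qed

text \<open>The cube carries the subspace topology of the full function space, so both restrictions
  merge into one.\<close>

lemma state_morphism_topology_eq:
  "state_morphism_topology imp imp' zero = top_of_set (state_morphisms imp imp' zero)"
proof -
  have "PiE UNIV (\<lambda>_. {0..1::real}) \<inter> state_morphisms imp imp' zero = state_morphisms imp imp' zero"
    by (auto simp: state_morphisms_def PiE_UNIV_domain)
  then show ?thesis
    unfolding state_morphism_topology_def
    by (simp add: subtopology_product_topology[symmetric] euclidean_product_topology subtopology_subtopology)
qed

lemma sets_borel_of_top_of_set:
  assumes "W \<in> sets borel"
  shows "sets (borel_of (top_of_set W)) = (\<inter>) W ` sets borel"
proof -
  have "{U. openin (top_of_set W) U} = (\<inter>) W ` {U. open U}"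
    by (auto simp: openin_open)
  then have "sets (borel_of (top_of_set W)) = sigma_sets W ((\<inter>) W ` {U. open U})"
    unfolding borel_of_def by (simp add: sets_measure_of image_subset_iff)
  also have "\<dots> = (\<inter>) W ` sigma_sets UNIV {U. open U}"
    using assms by (intro sigma_sets_Int[symmetric]) (simp_all add: sets_borel)
  finally show ?thesis by (simp add: sets_borel)
qed

definition unit_clip :: "real \<Rightarrow> real" where "unit_clip y = max 0 (min 1 y)"

lemma unit_clip_bounds: "0 \<le> unit_clip y" "unit_clip y \<le> 1"
  and unit_clip_id: "y \<in> {0..1} \<Longrightarrow> unit_clip y = y"
  by (auto simp: unit_clip_def)

text \<open>Clipping makes the coordinate bounded on the whole function type; it has no effect on states.\<close>

definition coordinate :: "'a \<Rightarrow> (('a \<Rightarrow> real) discrete \<Rightarrow>\<^sub>C real)" where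
  "coordinate a = bfun (\<lambda>t. unit_clip (t a))"

lemma bounded_clipped_coordinate: "bounded (range (\<lambda>t::'a \<Rightarrow> real. unit_clip (t a)))"
  by (rule boundedI[of _ 1]) (auto simp: unit_clip_bounds)

lemma at_point_coordinate: "t a \<in> {0..1} \<Longrightarrow> at_point (coordinate a) t = t a"
  by (simp add: coordinate_def at_point_bfun[OF bounded_clipped_coordinate] unit_clip_id)

lemma span_coordinate_affine:
  assumes K: "\<And>t x. t \<in> K \<Longrightarrow> t x \<in> {0..1::real}" and g: "g \<in> span (range coordinate)"
  shows "continuous_on K (at_point g) \<and> affine_fun_on K (at_point g)"
proof -
  let ?T = "{g. continuous_on K (at_point g) \<and> affine_fun_on K (at_point g)}"
  have "coordinate a \<in> ?T" for a
  proof -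
    have eq: "at_point (coordinate a) t = t a" if "t \<in> K" for t
      by (rule at_point_coordinate) (rule K[OF that])
    have "continuous_on K (at_point (coordinate a)) \<longleftrightarrow> continuous_on K (\<lambda>t. t a)"
      by (rule continuous_on_cong) (auto simp: eq)
    moreover have "continuous_on K (\<lambda>t. t a)"
      by (rule continuous_on_subset[OF continuous_on_product_coordinates]) simp
    moreover have "affine_fun_on K (at_point (coordinate a))"
      unfolding affine_fun_on_def by (simp add: eq)
    ultimately show ?thesis by simp
  qed
  moreover have "subspace ?T"
  proof (rule subspaceI)
    show "0 \<in> ?T"
      by (simp add: affine_fun_on_def)
    fix f h assume "f \<in> ?T" "h \<in> ?T"
    moreover have "at_point (f + h) = (\<lambda>t. at_point f t + at_point h t)"
      by (rule ext) simp
    ultimately show "f + h \<in> ?T"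
      by (simp add: affine_fun_on_add continuous_on_add)
  next
    fix r f assume "f \<in> ?T"
    moreover have "at_point (r *\<^sub>R f) = (\<lambda>t. r * at_point f t)"
      by (rule ext) simp
    ultimately show "r *\<^sub>R f \<in> ?T"
      by (simp add: affine_fun_on_mult_left continuous_on_mult_left)
  qed
  ultimately show ?thesis
    using span_minimal[of "range coordinate" ?T] g by blast
qed

text \<open>The maximum principle for \<open>- g\<close> yields an extreme state that minimises
  \<open>g\<close>. This state is a state-morphism, where \<open>g\<close> is nonnegative by
  assumption.\<close>

lemma (in bosbach) nonneg_at_state:
  assumes g: "g \<in> span (range coordinate)"
    and pos: "\<And>t. t \<in> state_morphisms imp imp' zero \<Longrightarrow> 0 \<le> at_point g t"
  shows "0 \<le> at_point g s"
proof -
  define K where "K = {t. bosbach_state imp imp' one zero t}"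
  have K: "compact K" "s \<in> K"
    using compact_bosbach_states bosbach_state unfolding K_def by simp_all
  have "- g \<in> span (range coordinate)" using g by (rule span_neg)
  then have aff: "continuous_on K (at_point (- g))" "affine_fun_on K (at_point (- g))"
    using span_coordinate_affine[of K "- g"] by (auto simp: K_def bosbach_state_def)
  obtain t where t: "t \<in> K" "\<And>t'. t' \<in> K \<Longrightarrow> at_point (- g) t' \<le> at_point (- g) t"
    and extreme: "\<And>t1 t2 r. \<lbrakk>t1 \<in> K; t2 \<in> K; 0 < r; r < 1; t = (\<lambda>x. r * t1 x + (1 - r) * t2 x)\<rbrakk> \<Longrightarrow> t1 = t"
    using affine_attains_max_at_extreme_point[OF K(1) _ aff] K(2) by blast
  interpret t: bosbach le imp imp' one zero t
    using t(1) by unfold_locales (simp add: K_def)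
  have "t \<in> state_morphisms imp imp' zero"
    by (rule t.extreme_state_morphism) (rule extreme, simp_all add: K_def)
  from pos[OF this] t(2)[OF K(2)] show ?thesis by simp
qed

section \<open>Integral representation of Bosbach states\<close>

theorem theorem6p3:
  fixes le :: "'a \<Rightarrow> 'a \<Rightarrow> bool"
    and imp imp' :: "'a \<Rightarrow> 'a \<Rightarrow> 'a"
    and one zero :: 'a
    and s :: "'a \<Rightarrow> real"
  assumes "bounded_pseudo_BCK le imp imp' one zero"
    and "bosbach_state imp imp' one zero s"
  shows "\<exists>\<mu> :: ('a \<Rightarrow> real) measure.
           sets \<mu> = sets (borel_of (state_morphism_topology imp imp' zero)) \<and>
           prob_space \<mu> \<and>
           (\<forall>a. integrable \<mu> (\<lambda>V. V a) \<and> s a = (\<integral>V. V a \<partial>\<mu>))"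
proof -
  interpret bounded_pseudo_BCK le imp imp' one zero by (rule assms(1))
  interpret bosbach le imp imp' one zero s by unfold_locales (rule assms(2))
  define W where "W = state_morphisms imp imp' zero"
  have W: "t x \<in> {0..1}" if "t \<in> W" for t x
    using that by (auto simp: W_def state_morphisms_def)
  have W_one: "t one = 1" if "t \<in> W" for t
  proof -
    have "t (imp zero zero) = 1" using that by (simp add: W_def state_morphisms_def del: zero_imp)
    then show ?thesis by (simp add: zero_imp)
  qed
  obtain I where I: "linear I"
    and I_coordinate: "\<And>g. g \<in> span (range coordinate) \<Longrightarrow> I g = at_point g s"
    and I_nonpos: "\<And>f. (\<forall>t\<in>W. at_point f t \<le> 0) \<Longrightarrow> I f \<le> 0"
  proof (rule point_evaluation_extends)
    show "subspace (span (range coordinate))" by (rule subspace_span)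
    \<comment> \<open>The coordinate at \<open>one\<close> serves as the unit: \<open>s\<close> and
      all state-morphisms take the value 1 there.\<close>
    show "coordinate one \<in> span (range coordinate)" by (rule span_base) simp
    show "at_point (coordinate one) s = 1"
      using at_point_coordinate[of s one] state_one by simp
    show "at_point (coordinate one) t = 1" if "t \<in> W" for t
      using at_point_coordinate[of t one] W_one[OF that] by simp
    show "0 \<le> at_point g s" if "g \<in> span (range coordinate)" "\<And>t. t \<in> W \<Longrightarrow> 0 \<le> at_point g t" for g
      using nonneg_at_state that unfolding W_def by blast
  qed (rule that)
  have I_cong: "I f = I g" if "\<And>t. t \<in> W \<Longrightarrow> at_point f t = at_point g t" for f g
  proof -
    have "I (f - g) \<le> 0" "I (g - f) \<le> 0"
      using that by (auto intro: I_nonpos)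
    then show ?thesis by (simp add: linear_diff[OF I])
  qed
  have I_clip: "I (bfun (\<lambda>t. unit_clip (t a))) = s a" for a
    using I_coordinate[of "coordinate a"] at_point_coordinate[of s a] state_bounds[of a]
    by (simp add: span_base flip: coordinate_def)
  \<comment> \<open>On \<open>W\<close> the constant 1 agrees with the coordinate at
    \<open>one\<close>, and \<open>I\<close> sees only values on \<open>W\<close>; so the mean has
    total mass \<open>s one = 1\<close>.\<close>
  have "I (bfun (\<lambda>_. 1)) = I (bfun (\<lambda>t. unit_clip (t one)))"
    by (rule I_cong) (simp add: at_point_bfun bounded_clipped_coordinate W_one unit_clip_id)
  then have "compact_mean W (\<lambda>f. I (bfun f))"
    using compact_state_morphisms[of imp imp' zero] I I_nonpos
    by (intro compact_mean_functional Hausdorff_space_fun) (simp_all add: I_clip state_one W_def)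
  then obtain \<mu> where \<mu>: "sets \<mu> = (\<inter>) W ` sets borel" "prob_space \<mu>"
    and repr: "\<And>f. \<lbrakk>bounded (range f); continuous_on W f; \<forall>x\<in>W. f x \<in> {0..1}\<rbrakk>
      \<Longrightarrow> integrable \<mu> f \<and> I (bfun f) = (\<integral>t. f t \<partial>\<mu>)"
    by (rule compact_mean.representing_measure) (rule that)
  have "W \<in> sets borel"
    unfolding W_def
    by (intro borel_closed compact_imp_closed_Hausdorff Hausdorff_space_fun compact_state_morphisms)
  then have sets: "sets \<mu> = sets (borel_of (state_morphism_topology imp imp' zero))"
    by (simp add: \<mu>(1) state_morphism_topology_eq sets_borel_of_top_of_set flip: W_def)
  have space: "space \<mu> = W"
    using sets_eq_imp_space_eq[OF sets]
    by (simp add: borel_of_def topspace_state_morphism_topology space_measure_of_conv W_def)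
  have "integrable \<mu> (\<lambda>V. V a) \<and> s a = (\<integral>V. V a \<partial>\<mu>)" for a
  proof -
    have eq: "unit_clip (V a) = V a" if "V \<in> space \<mu>" for V
      using W[of V a] that space unit_clip_id by simp
    have "continuous_on W (\<lambda>V. unit_clip (V a))"
      unfolding unit_clip_def
      by (intro continuous_intros continuous_on_subset[OF continuous_on_product_coordinates]) simp
    from repr[OF bounded_clipped_coordinate this]
    have "integrable \<mu> (\<lambda>V. unit_clip (V a))" "s a = (\<integral>V. unit_clip (V a) \<partial>\<mu>)"
      by (simp_all add: I_clip unit_clip_bounds)
    then show ?thesis
      using eq by (simp cong: Bochner_Integration.integrable_cong Bochner_Integration.integral_cong)
  qed
  with sets \<mu>(2) show ?thesis by blast
qed

end
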